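(* Let $\mathbb W$, $C$ and $G$ be as in the context, and suppose there exist $1\le i\le l$ with $k_i=1$ (i.e. the exponent $m_i$ occurs exactly once) and a prime $p\equiv 3\pmod 4$ dividing $m_i$. Then the natural short exact sequence $1\to\operatorname{Inn}(\mathbb W)\to\operatorname{Aut}(\mathbb W)\to\operatorname{Out}(\mathbb W)\to 1$ splits. More precisely, there is a subgroup $D\le C$ with $D\cap\langle\widehat{w_1}\rangle=1$ and $C=D\langle\widehat{w_1}\rangle$ such that $G$ normalises $D$, $DG$ is a complement of $\operatorname{Inn}(\mathbb W)$ in $\operatorname{Aut}(\mathbb W)$, and $\operatorname{Out}(\mathbb W)\cong D\rtimes G$.
   Context: Fix an integer $n\ge 3$, pairwise distinct odd integers $m_1,\dots,m_l\ge 3$ and positive integers $k_1,\dots,k_l$ with $k_1+\cdots+k_l=n-1$. Partition $\{2,\dots,n\}$ into consecutive blocks $A_1=\{2,\dots,k_1+1\}$, $A_2=\{k_1+2,\dots,k_1+k_2+1\}$, …, $A_l$ (of sizes $k_1,\dots,k_l$), and put $t_i=m_j$ for $i\in A_j$. The star group is $\mathbb W=\langle w_1,\dots,w_n\mid w_j^2=1\ (1\le j\le n),\ (w_1w_i)^{t_i}=1\ (2\le i\le n)\rangle$. For $2\le i\le n$ and $1\le k<t_i$ with $\gcd(k,t_i)=1$, $\theta_i^k$ is the automorphism of $\mathbb W$ with $\theta_i^k(w_j)=w_j$ for $j\ne i$ and $\theta_i^k(w_i)=w_1(w_1w_i)^k$. Let $C_i=\langle\theta_i^k : 1\le k<t_i,\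 \gcd(k,t_i)=1\rangle\cong \operatorname{U}_{t_i}$ and $C=C_2\times\cdots\times C_n\le\operatorname{Aut}(\mathbb W)$. $\widehat{w_1}$ is the inner automorphism $x\mapsto w_1xw_1$. $G$ is the group of graph automorphisms: the automorphisms $\tilde\alpha$ of $\mathbb W$ with $\tilde\alpha(w_1)=w_1$ and $\tilde\alpha(w_i)=w_{\alpha(i)}$ ($2\le i\le n$), where $\alpha$ ranges over permutations of $\{2,\dots,n\}$ with $\alpha(A_j)=A_j$ for all $j$. $\operatorname{Out}(\mathbb W)=\operatorname{Aut}(\mathbb W)/\operatorname{Inn}(\mathbb W)$. *)

theory Defs
  imports "HOL-Algebra.Algebra" "HOL-Combinatorics.Permutations" "HOL-Computational_Algebra.Primes"
begin

text \<open>Words are lists over the letters {1..n}; since every generator is an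
involution (w_j^2 = 1 is among the relations) the monoid presented is a group.
pres_eq R is the congruence on words generated by the relation pairs R.\<close>

inductive pres_eq :: "(nat list \<times> nat list) set \<Rightarrow> nat list \<Rightarrow> nat list \<Rightarrow> bool"
  for R where
  base: "(u, v) \<in> R \<Longrightarrow> pres_eq R u v"
| refl: "pres_eq R u u"
| sym: "pres_eq R u v \<Longrightarrow> pres_eq R v u"
| trans: "pres_eq R u v \<Longrightarrow> pres_eq R v w \<Longrightarrow> pres_eq R u w"
| app: "pres_eq R u v \<Longrightarrow> pres_eq R (a @ u @ b) (a @ v @ b)"

definition words :: "nat \<Rightarrow> nat list set" where
  "words n = {xs. set xs \<subseteq> {1..n}}"

definition pres_class :: "nat \<Rightarrow> (nat list \<times> nat list) set \<Rightarrow> nat list \<Rightarrow> nat list set" where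
  "pres_class n R xs = {ys \<in> words n. pres_eq R xs ys}"

definition pres_group :: "nat \<Rightarrow> (nat list \<times> nat list) set \<Rightarrow> nat list set monoid" where
  "pres_group n R =
     \<lparr>carrier = pres_class n R ` words n,
      monoid.mult = (\<lambda>U V. pres_class n R ((SOME xs. xs \<in> U) @ (SOME ys. ys \<in> V))),
      one = pres_class n R []\<rparr>"

definition star_rels :: "nat \<Rightarrow> (nat \<Rightarrow> nat) \<Rightarrow> (nat list \<times> nat list) set" where
  "star_rels n t = {([j, j], []) | j. j \<in> {1..n}}
                 \<union> {(concat (replicate (t i) [1, i]), []) | i. i \<in> {2..n}}"

definition star_group :: "nat \<Rightarrow> (nat \<Rightarrow> nat) \<Rightarrow> nat list set monoid" where
  "star_group n t = pres_group n (star_rels n t)"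

definition gen :: "nat \<Rightarrow> (nat \<Rightarrow> nat) \<Rightarrow> nat \<Rightarrow> nat list set" where
  "gen n t i = pres_class n (star_rels n t) [i]"

definition block :: "(nat \<Rightarrow> nat) \<Rightarrow> nat \<Rightarrow> nat set" where
  "block k j = {2 + (\<Sum>s\<in>{1..<j}. k s) .. 1 + (\<Sum>s\<in>{1..j}. k s)}"

definition expo :: "nat \<Rightarrow> (nat \<Rightarrow> nat) \<Rightarrow> (nat \<Rightarrow> nat) \<Rightarrow> nat \<Rightarrow> nat" where
  "expo l m k i = m (THE j. j \<in> {1..l} \<and> i \<in> block k j)"

abbreviation Aut :: "nat list set monoid \<Rightarrow> (nat list set \<Rightarrow> nat list set) monoid" where
  "Aut W \<equiv> AutoGroup W"

definition inner :: "('a, 'b) monoid_scheme \<Rightarrow> 'a \<Rightarrow> ('a \<Rightarrow> 'a)" where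
  "inner W g = restrict (\<lambda>x. g \<otimes>\<^bsub>W\<^esub> x \<otimes>\<^bsub>W\<^esub> inv\<^bsub>W\<^esub> g) (carrier W)"

definition Inn :: "('a, 'b) monoid_scheme \<Rightarrow> ('a \<Rightarrow> 'a) set" where
  "Inn W = inner W ` carrier W"

definition Out :: "('a, 'b) monoid_scheme \<Rightarrow> ('a \<Rightarrow> 'a) set monoid" where
  "Out W = AutoGroup W Mod Inn W"

definition theta :: "nat \<Rightarrow> (nat \<Rightarrow> nat) \<Rightarrow> nat \<Rightarrow> nat \<Rightarrow> (nat list set \<Rightarrow> nat list set)" where
  "theta n t i k = (THE \<phi>. \<phi> \<in> auto (star_group n t) \<and>
      (\<forall>j\<in>{1..n}. j \<noteq> i \<longrightarrow> \<phi> (gen n t j) = gen n t j) \<and>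
      \<phi> (gen n t i) = gen n t 1 \<otimes>\<^bsub>star_group n t\<^esub>
                       (gen n t 1 \<otimes>\<^bsub>star_group n t\<^esub> gen n t i) [^]\<^bsub>star_group n t\<^esub> k)"

text \<open>C = C_2 x ... x C_n, the (internal) product of the C_i = <theta i k : gcd(k, t_i) = 1>.\<close>
definition Cgrp :: "nat \<Rightarrow> (nat \<Rightarrow> nat) \<Rightarrow> (nat list set \<Rightarrow> nat list set) set" where
  "Cgrp n t = generate (Aut (star_group n t))
     {theta n t i k | i k. i \<in> {2..n} \<and> 1 \<le> k \<and> k < t i \<and> coprime k (t i)}"

definition graph_aut :: "nat \<Rightarrow> (nat \<Rightarrow> nat) \<Rightarrow> (nat \<Rightarrow> nat) \<Rightarrow> (nat list set \<Rightarrow> nat list set)" where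
  "graph_aut n t \<alpha> = (THE \<phi>. \<phi> \<in> auto (star_group n t) \<and>
      \<phi> (gen n t 1) = gen n t 1 \<and> (\<forall>i\<in>{2..n}. \<phi> (gen n t i) = gen n t (\<alpha> i)))"

definition Ggrp :: "nat \<Rightarrow> nat \<Rightarrow> (nat \<Rightarrow> nat) \<Rightarrow> (nat \<Rightarrow> nat)
                     \<Rightarrow> (nat list set \<Rightarrow> nat list set) set" where
  "Ggrp n l k t = {graph_aut n t \<alpha> | \<alpha>. \<alpha> permutes {2..n} \<and> (\<forall>j\<in>{1..l}. \<alpha> ` block k j = block k j)}"

definition conj_semidirect :: "('a, 'b) monoid_scheme \<Rightarrow> 'a set \<Rightarrow> 'a set \<Rightarrow> ('a \<times> 'a) monoid" where
  "conj_semidirect H N K =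
     \<lparr>carrier = N \<times> K,
      monoid.mult = (\<lambda>(n1, k1) (n2, k2). (n1 \<otimes>\<^bsub>H\<^esub> (k1 \<otimes>\<^bsub>H\<^esub> n2 \<otimes>\<^bsub>H\<^esub> inv\<^bsub>H\<^esub> k1), k1 \<otimes>\<^bsub>H\<^esub> k2)),
      one = (\<one>\<^bsub>H\<^esub>, \<one>\<^bsub>H\<^esub>)\<rparr>"

end

theory Submission
  imports Defs "HOL-Number_Theory.Residues"
begin

text \<open>
  Write \<open>s = w\<^sub>1\<close> and \<open>r\<^sub>i = w\<^sub>1 w\<^sub>i\<close>. Then \<open>W\<close> is the semidirect product of the free product \<open>K\<close> of the
  cyclic groups \<open>\<langle>r\<^sub>i\<rangle>\<close> of odd order \<open>t\<^sub>i\<close> with \<open>\<langle>s\<rangle>\<close>, where \<open>s\<close> inverts every \<open>r\<^sub>i\<close>. Reading off normal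
  forms in \<open>K\<close>: an involution is \<open>x s\<close> with \<open>x\<close> a palindrome, so it is conjugate to \<open>s\<close> (the middle
  letter has a square root as \<open>t\<^sub>i\<close> is odd); if moreover \<open>x\<close> has finite order, then \<open>x\<close> has length at
  most one; and \<open>s\<close> centralises only itself and the identity. Hence every automorphism is, up to an
  inner one, an automorphism fixing \<open>s\<close>, and the latter permute the subgroups \<open>\<langle>r\<^sub>i\<rangle>\<close>: they form the
  product of \<open>C\<close> and \<open>G\<close>, which meets the inner automorphisms in conjugation by \<open>s\<close>.

  Conjugation by \<open>s\<close> is the tuple \<open>(-1, \<dots>, -1)\<close> in \<open>C\<close>. Let \<open>i\<close> be the index with the exponent occurring
  only once and \<open>p\<close> the given prime. As \<open>p \<equiv> 3\<close> modulo 4, \<open>q = (p - 1) div 2\<close> is odd, so \<open>c\<^sup>q\<close> is \<open>1\<close> or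
  \<open>-1\<close> modulo \<open>p\<close> and changes sign with \<open>c\<close>; the condition that the \<open>i\<close>-th coordinate \<open>c\<close> satisfies
  \<open>c\<^sup>q \<equiv> 1\<close> therefore defines the required complement \<open>D\<close>. It is normalised by \<open>G\<close>, since \<open>G\<close> fixes \<open>i\<close>.
\<close>

section \<open>Normal forms in a free product of cyclic groups\<close>

text \<open>The letter \<open>(i, a)\<close> stands for the power \<open>r\<^sub>i\<^sup>a\<close>.\<close>

definition reduced :: "'i set \<Rightarrow> ('i \<Rightarrow> nat) \<Rightarrow> ('i \<times> nat) list \<Rightarrow> bool" where
  "reduced I t xs \<longleftrightarrow> (\<forall>(i, a)\<in>set xs. i \<in> I \<and> 0 < a \<and> a < t i) \<and> distinct_adj (map fst xs)"

text \<open>Models conjugation by \<open>s\<close>: every letter is inverted in place. The inverse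
  of a word in the free product is \<open>rev (neg t xs)\<close>.\<close>

definition neg :: "('i \<Rightarrow> nat) \<Rightarrow> ('i \<times> nat) list \<Rightarrow> ('i \<times> nat) list" where
  "neg t = map (\<lambda>(i, a). (i, t i - a))"

definition cons_red :: "'i \<Rightarrow> nat \<Rightarrow> ('i \<times> nat) list \<Rightarrow> ('i \<times> nat) list" where
  "cons_red i c xs = (if c = 0 then xs else (i, c) # xs)"

text \<open>Left multiplication of a normal form by the \<open>a\<close>-th power of the generator
  \<open>i\<close>. Only the first letter can merge; if it cancels, the next letter has another
  index and the rest is already reduced.\<close>

fun lmul :: "('i \<Rightarrow> nat) \<Rightarrow> 'i \<Rightarrow> nat \<Rightarrow> ('i \<times> nat) list \<Rightarrow> ('i \<times> nat) list" where
  "lmul t i a [] = cons_red i (a mod t i) []"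
| "lmul t i a ((j, b) # xs) =
     (if j = i then cons_red i ((a + b) mod t i) xs else cons_red i (a mod t i) ((j, b) # xs))"

lemma reduced_Nil [simp]: "reduced I t []"
  by (simp add: reduced_def)

lemma reduced_Cons:
  "reduced I t ((i, a) # xs) \<longleftrightarrow>
     i \<in> I \<and> 0 < a \<and> a < t i \<and> reduced I t xs \<and> (xs = [] \<or> fst (hd xs) \<noteq> i)"
  by (cases xs) (auto simp: reduced_def)

lemma map_fst_neg [simp]: "map fst (neg t xs) = map fst xs"
  by (induction xs) (auto simp: neg_def)

lemma neg_simps [simp]:
  "neg t [] = []" "neg t ((i, a) # xs) = (i, t i - a) # neg t xs"
  "neg t (xs @ ys) = neg t xs @ neg t ys" "neg t (rev xs) = rev (neg t xs)"
  by (simp_all add: neg_def rev_map)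

lemma reduced_neg: "reduced I t xs \<Longrightarrow> reduced I t (neg t xs)"
  unfolding reduced_def map_fst_neg by (auto simp: neg_def)

lemma reduced_rev: "reduced I t (rev xs) \<longleftrightarrow> reduced I t xs"
  by (simp add: reduced_def rev_map[symmetric])

lemma neg_neg: "reduced I t xs \<Longrightarrow> neg t (neg t xs) = xs"
  by (induction xs) (auto simp: reduced_Cons)

lemma reduced_lmul:
  assumes "reduced I t xs" "i \<in> I" "0 < t i"
  shows "reduced I t (lmul t i a xs)"
  using assms by (cases xs) (auto simp: reduced_Cons cons_red_def)

lemma lmul_reduced_Cons: "reduced I t ((i, a) # xs) \<Longrightarrow> lmul t i a xs = (i, a) # xs"
  by (cases xs) (auto simp: reduced_Cons cons_red_def)

lemma lmul_cons_red:
  assumes "xs = [] \<or> fst (hd xs) \<noteq> i"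
  shows "lmul t i a (cons_red i c xs) = cons_red i ((a + c) mod t i) xs"
  using assms by (cases xs) (auto simp: cons_red_def)

lemma neg_cons_red: "c < t i \<Longrightarrow> neg t (cons_red i c xs) = cons_red i ((t i - c) mod t i) (neg t xs)"
  by (auto simp: cons_red_def)

text \<open>A leading letter of index \<open>i\<close>, possibly with exponent 0, can always be
  split off. This turns \<open>lmul\<close> into addition modulo \<open>t i\<close> without case
  distinctions.\<close>

lemma reduced_cons_redE:
  assumes "reduced I t xs" "0 < t i"
  obtains c ys where "xs = cons_red i c ys" "c < t i" "ys = [] \<or> fst (hd ys) \<noteq> i"
proof (cases "xs = [] \<or> fst (hd xs) \<noteq> i")
  case True
  then show ?thesis using that[of 0 xs] assms by (simp add: cons_red_def)
next
  case False
  then obtain c ys where "xs = (i, c) # ys" by (cases xs) auto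
  then show ?thesis using that[of c ys] assms(1) by (auto simp: reduced_Cons cons_red_def)
qed

lemma lmul_lmul:
  assumes "reduced I t xs" "0 < t i"
  shows "lmul t i a (lmul t i b xs) = lmul t i (a + b) xs"
proof -
  obtain c ys where "xs = cons_red i c ys" "c < t i" "ys = [] \<or> fst (hd ys) \<noteq> i"
    using reduced_cons_redE[OF assms] .
  then show ?thesis by (simp add: lmul_cons_red mod_simps add.assoc)
qed

text \<open>For \<open>a = t i\<close> this is the relation \<open>r\<^sub>i\<^sup>t = 1\<close> on
  normal forms; \<open>a = 0\<close> starts the inductions on powers.\<close>

lemma lmul_multiple:
  assumes "reduced I t xs" "0 < t i" "t i dvd a"
  shows "lmul t i a xs = xs"
proof -
  obtain c ys where "xs = cons_red i c ys" "c < t i" "ys = [] \<or> fst (hd ys) \<noteq> i"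
    using reduced_cons_redE[OF assms(1,2)] .
  moreover have "(a + c) mod t i = c mod t i" using assms(3) by (auto simp: dvd_def)
  ultimately show ?thesis by (simp add: lmul_cons_red)
qed

text \<open>On the leading exponent the composite of \<open>lmul\<close> and \<open>neg\<close>
  sends \<open>c\<close> to \<open>-(a + c)\<close>, an involution. For \<open>a = 1\<close> this is
  the relation \<open>w\<^sub>i\<^sup>2 = 1\<close> on normal forms.\<close>

lemma neg_lmul:
  assumes "reduced I t xs" "0 < t i"
  shows "neg t (lmul t i a (neg t (lmul t i a xs))) = xs"
proof -
  obtain c ys where xs: "xs = cons_red i c ys" "c < t i" "ys = [] \<or> fst (hd ys) \<noteq> i"
    using reduced_cons_redE[OF assms] .
  have hd: "neg t ys = [] \<or> fst (hd (neg t ys)) \<noteq> i"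
    using xs(3) by (cases ys) auto
  have "reduced I t ys" using assms(1) xs(1) by (auto simp: cons_red_def reduced_Cons split: if_splits)
  define d where "d = (a + c) mod t i"
  define e where "e = (a + (t i - d) mod t i) mod t i"
  have lt: "d < t i" "e < t i" using assms(2) by (simp_all add: d_def e_def)
  \<comment> \<open>The congruence is computed over the integers, where the natural subtractions
    become honest differences.\<close>
  have "int ((t i - e) mod t i) = (int (t i) - int e) mod int (t i)"
    using lt by (simp add: zmod_int of_nat_diff)
  also have "\<dots> = (int (t i) - (int a + (int (t i) - (int a + int c)))) mod int (t i)"
  proof -
    have "int e = (int a + (int (t i) - (int a + int c)) ) mod int (t i)"
      using lt by (simp add: e_def zmod_int of_nat_diff mod_simps) (simp add: d_def zmod_int mod_simps)
    then show ?thesis by (simp add: mod_simps)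
  qed
  also have "\<dots> = int c mod int (t i)" by simp
  finally have "(t i - e) mod t i = c" using xs(2) by (simp add: zmod_int[symmetric])
  then show ?thesis
    using xs hd lt \<open>reduced I t ys\<close>
    by (simp add: lmul_cons_red neg_cons_red d_def[symmetric] e_def[symmetric] neg_neg)
qed

section \<open>Palindromes among the normal forms\<close>

lemma palindrome_odd_length:
  assumes "rev xs = xs" "distinct_adj xs" "xs \<noteq> []"
  shows "odd (length xs)"
proof
  assume "even (length xs)"
  then obtain q where q: "length xs = 2 * q" by blast
  with assms(3) have "0 < q" by (cases q) auto
  \<comment> \<open>The two letters around the centre of an even palindrome mirror each other, yet
    they are adjacent.\<close>
  then have "xs ! (q - 1) = xs ! q"
    using rev_nth[of q xs] q assms(1) by (simp add: mult_2)
  then show False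
    using distinct_adj_nth[OF assms(2), of "q - 1"] \<open>0 < q\<close> q by simp
qed

lemma reduced_palindrome_split:
  assumes "reduced I t xs" "rev xs = xs" "xs \<noteq> []"
  obtains u x where "xs = u @ x # rev u"
proof -
  have "odd (length xs)"
  proof -
    have "rev (map fst xs) = map fst xs" using assms(2) by (metis rev_map)
    then show ?thesis
      using palindrome_odd_length[of "map fst xs"] assms by (auto simp: reduced_def)
  qed
  then obtain q where q: "length xs = 2 * q + 1" by (elim oddE)
  have "rev (take q xs) = drop (Suc q) xs"
    using assms(2) q by (metis rev_take Suc_eq_plus1 mult_2 add_Suc_right add.commute diff_add_inverse)
  then have "xs = take q xs @ xs ! q # rev (take q xs)"
    using id_take_nth_drop[of q xs] q by simp
  then show ?thesis using that by blast
qed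

text \<open>The middle letter of a self-inverse word satisfies \<open>a = t i - a\<close>,
  impossible for odd \<open>t i\<close>. This will exclude involutions in the free product.\<close>

lemma reduced_antipalindrome:
  assumes "reduced I t xs" "rev (neg t xs) = xs" "\<And>i. i \<in> I \<Longrightarrow> odd (t i)"
  shows "xs = []"
proof (rule ccontr)
  assume "xs \<noteq> []"
  have "odd (length xs)"
  proof -
    have "rev (map fst xs) = map fst xs" using assms(2) by (metis rev_map map_fst_neg)
    then show ?thesis
      using palindrome_odd_length[of "map fst xs"] assms \<open>xs \<noteq> []\<close> by (auto simp: reduced_def)
  qed
  then obtain q where q: "length xs = 2 * q + 1" by (elim oddE)
  obtain i a where ia: "xs ! q = (i, a)" by fastforce
  have l: "length (neg t xs) = length xs" by (simp add: neg_def)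
  have "xs ! q = neg t xs ! q"
    using rev_nth[of q "neg t xs"] q l assms(2) by simp
  then have "a = t i - a" using ia q by (simp add: neg_def)
  moreover have "i \<in> I" "a < t i"
    using assms(1) ia q nth_mem[of q xs] by (auto simp: reduced_def)
  ultimately have "t i = 2 * a" by simp
  then show False using assms(3)[OF \<open>i \<in> I\<close>] by simp
qed

lemma neg_fixed:
  assumes "reduced I t xs" "neg t xs = xs" "\<And>i. i \<in> I \<Longrightarrow> odd (t i)"
  shows "xs = []"
proof (cases xs)
  case (Cons x ys)
  obtain i a where "x = (i, a)" by fastforce
  with Cons assms have "a = t i - a" "a < t i" "i \<in> I" by (auto simp: reduced_Cons)
  then have "t i = 2 * a" by simp
  then show ?thesis using assms(3)[OF \<open>i \<in> I\<close>] by simp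
qed

section \<open>Groups generated by an involution inverting a free product\<close>

text \<open>Only the relations are recorded. They suffice to rewrite products into normal form;
  uniqueness of normal forms is added in the locale \<open>star_group_nf\<close>.\<close>

locale star_rel = group W for W (structure) +
  fixes I :: "'i set" and t :: "'i \<Rightarrow> nat" and s :: 'a and r :: "'i \<Rightarrow> 'a"
  assumes t_ge: "i \<in> I \<Longrightarrow> 3 \<le> t i"
    and s_closed [simp]: "s \<in> carrier W"
    and r_closed [simp]: "i \<in> I \<Longrightarrow> r i \<in> carrier W"
    and s_s [simp]: "s \<otimes> s = \<one>"
    and s_r: "i \<in> I \<Longrightarrow> s \<otimes> r i \<otimes> s = inv (r i)"
    and r_order: "i \<in> I \<Longrightarrow> r i [^] t i = \<one>"
begin

definition rots :: "('i \<times> nat) list \<Rightarrow> 'a" where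
  "rots xs = foldr (\<lambda>(i, a) g. r i [^] a \<otimes> g) xs \<one>"

definition sgn :: "bool \<Rightarrow> 'a" where
  "sgn e = (if e then s else \<one>)"

abbreviation letters :: "('i \<times> nat) list \<Rightarrow> bool" where
  "letters xs \<equiv> fst ` set xs \<subseteq> I"

lemma reduced_letters: "reduced I t xs \<Longrightarrow> letters xs"
  by (auto simp: reduced_def)

lemma rots_Nil [simp]: "rots [] = \<one>"
  and rots_Cons [simp]: "rots ((i, a) # xs) = r i [^] a \<otimes> rots xs"
  by (simp_all add: rots_def)

lemma sgn_closed [simp]: "sgn e \<in> carrier W"
  by (simp add: sgn_def)

lemma sgn_Not: "s \<otimes> sgn e = sgn (\<not> e)"
  by (simp add: sgn_def)

lemma rots_closed [simp]: "letters xs \<Longrightarrow> rots xs \<in> carrier W"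
  by (induction xs) auto

lemma rots_append: "letters xs \<Longrightarrow> letters ys \<Longrightarrow> rots (xs @ ys) = rots xs \<otimes> rots ys"
  by (induction xs) (auto simp: m_assoc)

lemma inv_s [simp]: "inv s = s"
  by (rule inv_equality) auto

lemma s_cancel [simp]: "x \<in> carrier W \<Longrightarrow> s \<otimes> (s \<otimes> x) = x"
  by (simp add: m_assoc[symmetric])

lemma conj_s_mult:
  "x \<in> carrier W \<Longrightarrow> y \<in> carrier W \<Longrightarrow> s \<otimes> (x \<otimes> y) \<otimes> s = (s \<otimes> x \<otimes> s) \<otimes> (s \<otimes> y \<otimes> s)"
  by (simp add: m_assoc)

lemma conj_s_cancel: "x \<in> carrier W \<Longrightarrow> s \<otimes> (s \<otimes> x \<otimes> s) \<otimes> s = x"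
  by (simp add: m_assoc)

lemma conj_s_inv: "x \<in> carrier W \<Longrightarrow> inv (s \<otimes> x \<otimes> s) = s \<otimes> inv x \<otimes> s"
  by (simp add: inv_mult_group m_assoc)

lemma conj_s_eq_iff: "x \<in> carrier W \<Longrightarrow> y \<in> carrier W \<Longrightarrow> s \<otimes> x \<otimes> s = y \<longleftrightarrow> x = s \<otimes> y \<otimes> s"
  by (auto simp: conj_s_cancel)

lemma conj_s_pow: "x \<in> carrier W \<Longrightarrow> s \<otimes> (x [^] (a::nat)) \<otimes> s = (s \<otimes> x \<otimes> s) [^] a"
  by (induction a) (auto simp: conj_s_mult)

lemma s_r_pow: "i \<in> I \<Longrightarrow> s \<otimes> (r i [^] (a::nat)) \<otimes> s = inv (r i [^] a)"
  by (simp add: conj_s_pow s_r nat_pow_inv)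

lemma s_r_pow': "i \<in> I \<Longrightarrow> s \<otimes> inv (r i [^] (a::nat)) \<otimes> s = r i [^] a"
  by (metis conj_s_inv inv_inv nat_pow_closed r_closed s_r_pow)

lemma r_pow_mod: "i \<in> I \<Longrightarrow> r i [^] (a mod t i) = r i [^] a"
proof -
  assume i: "i \<in> I"
  have "r i [^] a = r i [^] (t i * (a div t i) + a mod t i)" by simp
  also have "\<dots> = (r i [^] t i) [^] (a div t i) \<otimes> r i [^] (a mod t i)"
    using i by (simp only: nat_pow_mult[symmetric] nat_pow_pow r_closed)
  also have "\<dots> = r i [^] (a mod t i)" using i by (simp add: r_order)
  finally show ?thesis by simp
qed

lemma r_pow_cong: "i \<in> I \<Longrightarrow> [a = b] (mod t i) \<Longrightarrow> r i [^] a = r i [^] b"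
  by (metis cong_def r_pow_mod)

lemma inv_r_pow: "i \<in> I \<Longrightarrow> a \<le> t i \<Longrightarrow> inv (r i [^] a) = r i [^] (t i - a)"
  by (rule inv_equality) (auto simp: nat_pow_mult r_order)

text \<open>The map from \<open>x\<close> to \<open>s \<otimes> inv x \<otimes> s\<close> reverses
  products and fixes every \<open>r i\<close>, so it reverses words.\<close>

lemma conj_s_rots_rev: "letters xs \<Longrightarrow> s \<otimes> inv (rots xs) \<otimes> s = rots (rev xs)"
proof (induction xs)
  case (Cons x xs)
  obtain i a where x: "x = (i, a)" by fastforce
  with Cons.prems have i: "i \<in> I" and l: "letters xs" by auto
  have "s \<otimes> inv (rots (x # xs)) \<otimes> s = (s \<otimes> inv (rots xs) \<otimes> s) \<otimes> (s \<otimes> inv (r i [^] a) \<otimes> s)"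
    using i l by (simp add: x inv_mult_group conj_s_mult)
  also have "\<dots> = rots (rev xs) \<otimes> r i [^] a"
    using Cons.IH[OF l] i by (simp add: s_r_pow')
  finally show ?case using i l by (simp add: rots_append x)
qed simp

lemma conj_s_rots: "reduced I t xs \<Longrightarrow> s \<otimes> rots xs \<otimes> s = rots (neg t xs)"
proof (induction xs)
  case (Cons x xs)
  obtain i a where x: "x = (i, a)" by fastforce
  with Cons.prems have i: "i \<in> I" "a \<le> t i" "reduced I t xs" by (auto simp: reduced_Cons)
  then show ?case
    using Cons.IH reduced_letters[OF i(3)]
    by (simp add: x conj_s_mult s_r_pow inv_r_pow)
qed simp

lemma inv_rots: "reduced I t xs \<Longrightarrow> inv (rots xs) = rots (rev (neg t xs))"
  using conj_s_rots_rev[of xs] conj_s_rots[of "rev xs"] reduced_letters[of xs]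
    reduced_letters[of "rev xs"]
  by (simp add: reduced_rev conj_s_eq_iff)

lemma rots_cons_red: "i \<in> I \<Longrightarrow> letters xs \<Longrightarrow> rots (cons_red i c xs) = r i [^] c \<otimes> rots xs"
  by (simp add: cons_red_def)

lemma rots_lmul:
  assumes "reduced I t xs" "i \<in> I"
  shows "rots (lmul t i a xs) = r i [^] a \<otimes> rots xs"
proof -
  have "0 < t i" using t_ge[OF assms(2)] by simp
  then obtain c ys where xs: "xs = cons_red i c ys" "c < t i" "ys = [] \<or> fst (hd ys) \<noteq> i"
    using reduced_cons_redE[OF assms(1)] by blast
  then have "letters ys"
    using reduced_letters[OF assms(1)] by (auto simp: cons_red_def split: if_splits)
  then show ?thesis
    using assms xs by (simp add: lmul_cons_red rots_cons_red r_pow_mod nat_pow_mult[symmetric] m_assoc)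
qed

definition nf :: "('i \<times> nat) list \<Rightarrow> bool \<Rightarrow> 'a" where
  "nf xs e = rots xs \<otimes> sgn e"

lemma nf_closed [simp]: "reduced I t xs \<Longrightarrow> nf xs e \<in> carrier W"
  by (simp add: nf_def reduced_letters)

text \<open>\<open>s_nf\<close> and \<open>r_nf\<close> describe left multiplication on normal
  forms; \<open>state_act\<close> later copies these formulas.\<close>

lemma s_nf: "reduced I t xs \<Longrightarrow> s \<otimes> nf xs e = nf (neg t xs) (\<not> e)"
proof -
  assume xs: "reduced I t xs"
  have "s \<otimes> nf xs e = (s \<otimes> rots xs \<otimes> s) \<otimes> (s \<otimes> sgn e)"
    using reduced_letters[OF xs] by (simp add: nf_def m_assoc)
  then show ?thesis by (simp add: conj_s_rots[OF xs] sgn_Not nf_def)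
qed

lemma r_nf: "reduced I t xs \<Longrightarrow> i \<in> I \<Longrightarrow> r i [^] a \<otimes> nf xs e = nf (lmul t i a xs) e"
  by (simp add: nf_def rots_lmul reduced_letters m_assoc)

end

section \<open>Involutions and centralisers from unique normal forms\<close>

locale star_group_nf = star_rel W I t s r for W (structure) and I :: "'i set" and t s r +
  assumes fin: "finite I" and ne: "I \<noteq> {}"
    and t_odd: "i \<in> I \<Longrightarrow> odd (t i)"
    and nf_ex: "g \<in> carrier W \<Longrightarrow> \<exists>xs e. reduced I t xs \<and> g = nf xs e"
    and nf_inj: "reduced I t xs \<Longrightarrow> reduced I t ys \<Longrightarrow> nf xs e = nf ys f \<Longrightarrow> xs = ys \<and> e = f"
begin

lemma rots_inj: "reduced I t xs \<Longrightarrow> reduced I t ys \<Longrightarrow> rots xs = rots ys \<Longrightarrow> xs = ys"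
  using nf_inj[of xs ys False False] reduced_letters by (simp add: nf_def sgn_def)

lemma s_ne_one: "s \<noteq> \<one>"
  using nf_inj[of "[]" "[]" True False] by (auto simp: nf_def sgn_def)

text \<open>Each power is represented by a word with at most one letter, and these words are
  compared.\<close>

lemma r_pow_eq_iff:
  assumes "i \<in> I" "j \<in> I"
  shows "r i [^] a = r j [^] b \<longleftrightarrow> (if i = j then [a = b] (mod t i) else t i dvd a \<and> t j dvd b)"
proof -
  have red: "reduced I t (cons_red k (c mod t k) [])" if "k \<in> I" for k c
    using that t_ge[OF that] by (auto simp: cons_red_def reduced_Cons)
  have eq: "rots (cons_red k (c mod t k) []) = r k [^] c" if "k \<in> I" for k c
    using that by (simp add: rots_cons_red r_pow_mod)
  have "r i [^] a = r j [^] b \<longleftrightarrow> cons_red i (a mod t i) [] = cons_red j (b mod t j) []"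
    using rots_inj[OF red red, OF assms] eq[OF assms(1)] eq[OF assms(2)] by metis
  also have "\<dots> \<longleftrightarrow> (if i = j then [a = b] (mod t i) else t i dvd a \<and> t j dvd b)"
    by (auto simp: cons_red_def cong_def mod_eq_0_iff_dvd)
  finally show ?thesis .
qed

lemma r_pow_eq_one_iff: "i \<in> I \<Longrightarrow> r i [^] a = \<one> \<longleftrightarrow> t i dvd a"
  using r_pow_eq_iff[of i i a 0] by (simp add: cong_0_iff)

text \<open>Without the factor \<open>s\<close> the involution would be a self-inverse word, which
  \<open>reduced_antipalindrome\<close> excludes. With it, \<open>x \<otimes> x = \<one>\<close>
  says that conjugation by \<open>s\<close> inverts \<open>rots xs\<close>, which amounts to the
  palindrome condition.\<close>

lemma involution_nf:
  assumes "x \<in> carrier W" "x \<otimes> x = \<one>" "x \<noteq> \<one>"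
  obtains xs where "reduced I t xs" "rev xs = xs" "x = rots xs \<otimes> s"
proof -
  obtain xs e where xs: "reduced I t xs" and x: "x = nf xs e"
    using nf_ex[OF assms(1)] by blast
  have l [simp]: "rots xs \<in> carrier W" using reduced_letters[OF xs] by simp
  have e
  proof (rule ccontr)
    assume "\<not> e"
    then have [simp]: "x = rots xs" by (simp add: x nf_def sgn_def)
    have "inv (rots xs) = rots xs" using assms(2) by (intro inv_equality) auto
    then have "rev (neg t xs) = xs"
      using inv_rots[OF xs] rots_inj[of "rev (neg t xs)" xs] xs
      by (simp add: reduced_rev reduced_neg)
    then have "xs = []" using reduced_antipalindrome[OF xs] t_odd by blast
    then show False using assms(3) by simp
  qed
  then have x: "x = rots xs \<otimes> s" by (simp add: x nf_def sgn_def)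
  have "(s \<otimes> rots xs \<otimes> s) \<otimes> rots xs = s \<otimes> (x \<otimes> x) \<otimes> s"
    by (simp add: x m_assoc)
  then have "inv (rots xs) = s \<otimes> rots xs \<otimes> s"
    using assms(2) by (intro inv_equality) auto
  then have "rots xs = rots (rev xs)"
    using conj_s_rots_rev[of xs] reduced_letters[OF xs] by (simp add: conj_s_cancel)
  then have "rev xs = xs"
    using rots_inj[of "rev xs" xs] xs by (simp add: reduced_rev)
  then show ?thesis using that xs x by blast
qed

text \<open>The conjugate of \<open>s\<close> by \<open>g\<close> is
  \<open>g \<otimes> (s \<otimes> inv g \<otimes> s) \<otimes> s\<close>, that is, \<open>g\<close>
  followed by its reversal and \<open>s\<close>. So \<open>g\<close> is half of the palindrome,
  including a square root of the middle letter.\<close>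

lemma involution_conj_s:
  assumes "x \<in> carrier W" "x \<otimes> x = \<one>" "x \<noteq> \<one>"
  obtains g where "g \<in> carrier W" "x = g \<otimes> s \<otimes> inv g"
proof -
  obtain xs where xs: "reduced I t xs" "rev xs = xs" and x: "x = rots xs \<otimes> s"
    using involution_nf[OF assms] .
  show ?thesis
  proof (cases "xs = []")
    case True
    then show ?thesis using that[of \<one>] x by simp
  next
    case False
    then obtain u i a where u: "xs = u @ (i, a) # rev u"
      using reduced_palindrome_split[OF xs] by (metis surj_pair)
    then have i: "i \<in> I" and l: "letters u" using reduced_letters[OF xs(1)] by auto
    \<comment> \<open>2 is invertible modulo the odd number \<open>t i\<close>, which halves the
      exponent \<open>a\<close>.\<close>
    obtain b where b: "[2 * b = a] (mod t i)"
    proof -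
      have "coprime 2 (t i)" using t_odd[OF i] by simp
      then obtain y where "[2 * y = 1] (mod t i)" using cong_solve_coprime_nat[of 2 "t i"] by auto
      then have "[2 * y * a = 1 * a] (mod t i)" by (rule cong_scalar_right)
      then show ?thesis using that[of "y * a"] by (simp add: mult.assoc)
    qed
    let ?g = "rots u \<otimes> r i [^] b"
    have [simp]: "rots u \<in> carrier W" "r i \<in> carrier W" using l i by auto
    have "?g \<otimes> s \<otimes> inv ?g = rots u \<otimes> r i [^] b \<otimes> (s \<otimes> inv (r i [^] b) \<otimes> s) \<otimes> (s \<otimes> inv (rots u) \<otimes> s) \<otimes> s"
      by (simp add: inv_mult_group m_assoc)
    also have "\<dots> = rots u \<otimes> r i [^] b \<otimes> r i [^] b \<otimes> rots (rev u) \<otimes> s"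
      by (simp only: s_r_pow'[OF i] conj_s_rots_rev[OF l])
    also have "\<dots> = rots u \<otimes> r i [^] (2 * b) \<otimes> rots (rev u) \<otimes> s"
      using l i by (simp add: m_assoc nat_pow_mult[symmetric] mult_2)
    also have "r i [^] (2 * b) = r i [^] a" using r_pow_cong[OF i b] .
    also have "rots u \<otimes> r i [^] a \<otimes> rots (rev u) \<otimes> s = x"
      using l i by (simp add: x u rots_append m_assoc)
    finally show ?thesis using that[of ?g] by simp
  qed
qed

text \<open>A palindrome with at least two letters begins and ends with the same letter, and its
  powers do not collapse; finite order leaves only words with at most one letter.\<close>

lemma involution_finite_order:
  assumes "x \<in> carrier W" "x \<otimes> x = \<one>" "x \<noteq> \<one>" "(x \<otimes> s) [^] (N::nat) = \<one>" "0 < N"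
  obtains i a where "i \<in> I" "x \<otimes> s = r i [^] (a::nat)"
proof -
  obtain xs where xs: "reduced I t xs" "rev xs = xs" and x: "x = rots xs \<otimes> s"
    using involution_nf[OF assms(1-3)] .
  have xsx: "x \<otimes> s = rots xs" using reduced_letters[OF xs(1)] by (simp add: x m_assoc)
  obtain i0 where "i0 \<in> I" using ne by blast
  consider "xs = []" | i a where "xs = [(i, a)]" | i a zs where "xs = (i, a) # zs @ [(i, a)]"
  proof (cases xs)
    case (Cons y ys)
    obtain i a where y: "y = (i, a)" by fastforce
    show ?thesis
    proof (cases ys rule: rev_cases)
      case (snoc zs z)
      have "last xs = hd xs" using xs(2) by (metis hd_rev)
      then have "z = y" by (simp add: Cons snoc)
      then show ?thesis using that(3) Cons snoc y by blast
    qed (use that(2) Cons y in blast)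
  qed (use that in blast)
  then show ?thesis
  proof cases
    case 1
    \<comment> \<open>The empty word is the zeroth power of any generator; nonemptiness of
      \<open>I\<close> provides an index.\<close>
    then show ?thesis using that[of i0 0] \<open>i0 \<in> I\<close> xsx by simp
  next
    case 2
    then show ?thesis using that[of i a] xs(1) xsx by (auto simp: reduced_Cons)
  next
    case (3 i a zs)
    have ia: "i \<in> I" "0 < a" "a < t i" using xs(1) 3 by (auto simp: reduced_Cons)
    define b where "b = (2 * a) mod t i"
    have b: "0 < b" "b < t i"
    proof -
      have "\<not> t i dvd 2 * a"
        using t_odd[OF ia(1)] ia(2,3) nat_dvd_not_less[of a "t i"]
        by (simp add: coprime_dvd_mult_right_iff)
      then show "0 < b" unfolding b_def by (simp add: dvd_eq_mod_eq_0)
      show "b < t i" using ia by (simp add: b_def)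
    qed
    have zs: "letters zs" "zs \<noteq> []" using xs(1) 3 by (auto simp: reduced_def)
    \<comment> \<open>In powers of \<open>rots xs\<close> the only merging is of the last letter with the next first one, giving
      exponent \<open>2a\<close>, which is nonzero modulo the odd number \<open>t i\<close>; so no power collapses.\<close>
    have step: "reduced I t ((i, a) # zs @ (i, b) # w)"
      "rots ((i, a) # zs @ (i, b) # w) = rots xs \<otimes> rots ((i, a) # w)"
      if w: "reduced I t ((i, a) # w)" for w
    proof -
      show "reduced I t ((i, a) # zs @ (i, b) # w)"
        using w xs(1) 3 b zs(2) by (auto simp: reduced_def distinct_adj_Cons distinct_adj_append_iff hd_append)
      have lw: "letters w" using w reduced_letters by force
      have "r i [^] b = r i [^] a \<otimes> r i [^] a"
        using ia(1) by (simp add: b_def r_pow_mod nat_pow_mult mult_2)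
      then show "rots ((i, a) # zs @ (i, b) # w) = rots xs \<otimes> rots ((i, a) # w)"
        using zs ia lw by (simp add: 3 rots_append m_assoc)
    qed
    have l: "rots xs \<in> carrier W" using reduced_letters[OF xs(1)] by simp
    \<comment> \<open>Remembering only the leading letter suffices: the next merge needs it, and it
      shows that the power is nontrivial.\<close>
    have "\<exists>w. reduced I t ((i, a) # w) \<and> rots ((i, a) # w) = rots xs [^] Suc M" for M
    proof (induction M)
      case 0
      show ?case using xs(1) 3 l by (intro exI[of _ "zs @ [(i, a)]"]) simp
    next
      case (Suc M)
      then obtain w where w: "reduced I t ((i, a) # w)" "rots ((i, a) # w) = rots xs [^] Suc M" by blast
      have "rots xs [^] Suc (Suc M) = rots xs \<otimes> rots xs [^] Suc M"
        using l nat_pow_Suc2 by blast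
      then show ?case using step[OF w(1)] w(2) by metis
    qed
    then obtain w where "reduced I t ((i, a) # w)" "rots ((i, a) # w) = rots xs [^] N"
      using assms(5) gr0_implies_Suc by metis
    then show ?thesis using rots_inj[of "(i, a) # w" "[]"] assms(4) xsx by simp
  qed
qed

text \<open>Commuting with \<open>s\<close> makes the word of \<open>g\<close> fixed by
  \<open>neg\<close>, hence empty; only the sign remains.\<close>

lemma centralizer_s:
  assumes "g \<in> carrier W" "g \<otimes> s = s \<otimes> g"
  shows "g = \<one> \<or> g = s"
proof -
  obtain xs e where xs: "reduced I t xs" and g: "g = nf xs e"
    using nf_ex[OF assms(1)] by blast
  have "nf (neg t xs) (\<not> e) = s \<otimes> g" using s_nf[OF xs] g by simp
  also have "\<dots> = nf xs (\<not> e)"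
    unfolding assms(2)[symmetric] using reduced_letters[OF xs] by (simp add: g nf_def sgn_def m_assoc)
  finally have "neg t xs = xs" using nf_inj reduced_neg[OF xs] xs by blast
  then have "xs = []" using neg_fixed[OF xs] t_odd by blast
  then show ?thesis by (auto simp: g nf_def sgn_def)
qed

end

section \<open>Automorphism groups and complements\<close>

text \<open>The map is easier to write down starting from \<open>H\<close>, later the record
  \<open>conj_semidirect\<close>; inverting it gives the isomorphism starting from the group
  \<open>G\<close>.\<close>

lemma (in group) iso_from_mult_preserving_bij:
  assumes bij: "bij_betw h (carrier H) (carrier G)"
    and mult: "\<And>x y. x \<in> carrier H \<Longrightarrow> y \<in> carrier H \<Longrightarrow>
                 x \<otimes>\<^bsub>H\<^esub> y \<in> carrier H \<and> h (x \<otimes>\<^bsub>H\<^esub> y) = h x \<otimes> h y"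
  shows "G \<cong> H"
proof (rule is_isoI, rule isoI)
  let ?g = "inv_into (carrier H) h"
  show "bij_betw ?g (carrier G) (carrier H)" using bij by (rule bij_betw_inv_into)
  show "?g \<in> hom G H"
  proof (rule homI)
    fix x assume "x \<in> carrier G"
    then show "?g x \<in> carrier H" using bij by (metis bij_betw_def inv_into_into)
  next
    fix x y assume xy: "x \<in> carrier G" "y \<in> carrier G"
    then have m: "?g x \<in> carrier H" "?g y \<in> carrier H" and e: "h (?g x) = x" "h (?g y) = y"
      using bij by (auto simp: bij_betw_def inv_into_into f_inv_into_f)
    show "?g (x \<otimes> y) = ?g x \<otimes>\<^bsub>H\<^esub> ?g y"
      by (rule inv_into_f_eq) (use mult[OF m] e bij in \<open>auto simp: bij_betw_def\<close>)
  qed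
qed

lemma (in group) inv_cancel:
  "g \<in> carrier G \<Longrightarrow> x \<in> carrier G \<Longrightarrow> inv g \<otimes> (g \<otimes> x) = x"
  "g \<in> carrier G \<Longrightarrow> x \<in> carrier G \<Longrightarrow> g \<otimes> (inv g \<otimes> x) = x"
  by (simp_all add: m_assoc[symmetric])

lemma (in group) subgroup_set_mult_normalised:
  assumes D: "subgroup D G" and K: "subgroup K G"
    and conj: "\<And>k d. k \<in> K \<Longrightarrow> d \<in> D \<Longrightarrow> k \<otimes> d \<otimes> inv k \<in> D"
  shows "subgroup (D <#> K) G"
proof (rule subgroupI)
  show "D <#> K \<subseteq> carrier G"
    by (simp add: set_mult_closed D K subgroup.subset)
  show "D <#> K \<noteq> {}"
    using subgroup.one_closed[OF D] subgroup.one_closed[OF K] unfolding set_mult_def by blast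
next
  fix x assume "x \<in> D <#> K"
  then obtain d k where dk: "d \<in> D" "k \<in> K" and x: "x = d \<otimes> k" unfolding set_mult_def by blast
  then have [simp]: "d \<in> carrier G" "k \<in> carrier G"
    using subgroup.mem_carrier[OF D] subgroup.mem_carrier[OF K] by auto
  have "inv x = (inv k \<otimes> inv d \<otimes> inv (inv k)) \<otimes> inv k"
    by (simp add: x inv_mult_group m_assoc)
  moreover have "inv k \<otimes> inv d \<otimes> inv (inv k) \<in> D" "inv k \<in> K"
    using conj[of "inv k" "inv d"] dk D K by (auto simp: subgroup.m_inv_closed)
  ultimately show "inv x \<in> D <#> K"
    unfolding set_mult_def by blast
next
  fix x y assume "x \<in> D <#> K" "y \<in> D <#> K"
  then obtain d k d' k' where dk: "d \<in> D" "k \<in> K" "d' \<in> D" "k' \<in> K"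
    and xy: "x = d \<otimes> k" "y = d' \<otimes> k'" unfolding set_mult_def by blast
  then have [simp]: "d \<in> carrier G" "k \<in> carrier G" "d' \<in> carrier G" "k' \<in> carrier G"
    using subgroup.mem_carrier[OF D] subgroup.mem_carrier[OF K] by auto
  have "x \<otimes> y = (d \<otimes> (k \<otimes> d' \<otimes> inv k)) \<otimes> (k \<otimes> k')"
    by (simp add: xy m_assoc inv_cancel)
  moreover have "d \<otimes> (k \<otimes> d' \<otimes> inv k) \<in> D" "k \<otimes> k' \<in> K"
    using conj[of k d'] dk D K by (auto simp: subgroup.m_closed)
  ultimately show "x \<otimes> y \<in> D <#> K"
    unfolding set_mult_def by blast
qed

text \<open>The comparison map sends \<open>(d, k)\<close> to the coset of
  \<open>d \<otimes> k\<close>. The two trivial intersections give injectivity, the factorisation of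
  the whole group gives surjectivity.\<close>

lemma (in group) Mod_iso_conj_semidirect:
  assumes N: "N \<lhd> G" and D: "subgroup D G" and K: "subgroup K G"
    and conj: "\<And>k d. k \<in> K \<Longrightarrow> d \<in> D \<Longrightarrow> k \<otimes> d \<otimes> inv k \<in> D"
    and DK: "D \<inter> K = {\<one>}" and DKN: "(D <#> K) \<inter> N = {\<one>}"
    and all: "(D <#> K) <#> N = carrier G"
  shows "G Mod N \<cong> conj_semidirect G D K"
proof -
  interpret N: normal N G by fact
  interpret M: group "G Mod N" by (rule N.factorgroup_is_group)
  interpret DKs: subgroup "D <#> K" G by (rule subgroup_set_mult_normalised[OF D K conj])
  note cl = subgroup.mem_carrier[OF D] subgroup.mem_carrier[OF K]
  let ?h = "\<lambda>(d, k). N #> (d \<otimes> k)"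
  show ?thesis
  proof (rule M.iso_from_mult_preserving_bij)
    show "bij_betw ?h (carrier (conj_semidirect G D K)) (carrier (G Mod N))"
    proof (rule bij_betw_imageI)
      show "inj_on ?h (carrier (conj_semidirect G D K))"
      proof (rule inj_onI, clarsimp simp: conj_semidirect_def)
        fix d k d' k'
        assume dk: "d \<in> D" "k \<in> K" "d' \<in> D" "k' \<in> K" and eq: "N #> (d \<otimes> k) = N #> (d' \<otimes> k')"
        then have [simp]: "d \<in> carrier G" "k \<in> carrier G" "d' \<in> carrier G" "k' \<in> carrier G"
          using cl by auto
        have mem: "d \<otimes> k \<in> D <#> K" "d' \<otimes> k' \<in> D <#> K" using dk unfolding set_mult_def by auto
        have "d \<otimes> k \<in> N #> (d' \<otimes> k')" using rcos_self[OF _ N.subgroup_axioms, of "d \<otimes> k"] eq by simp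
        then obtain a where a: "a \<in> N" "d \<otimes> k = a \<otimes> (d' \<otimes> k')" unfolding r_coset_def by blast
        \<comment> \<open>The discrepancy \<open>a\<close> between the two representatives lies both
          in \<open>N\<close> and in the subgroup \<open>D <#> K\<close>.\<close>
        then have "a = (d \<otimes> k) \<otimes> inv (d' \<otimes> k')" by (simp add: m_assoc)
        then have "a \<in> D <#> K" using mem by (metis DKs.m_closed DKs.m_inv_closed)
        then have "a = \<one>" using a DKN by blast
        then have e: "d \<otimes> k = d' \<otimes> k'" using a by simp
        \<comment> \<open>Equal products yield one element written both in \<open>D\<close> and in
          \<open>K\<close>.\<close>
        have "inv d' \<otimes> d = inv d' \<otimes> (d \<otimes> k) \<otimes> inv k" by (simp add: m_assoc)
        also have "\<dots> = k' \<otimes> inv k" unfolding e by (simp add: m_assoc inv_cancel)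
        finally have e': "inv d' \<otimes> d = k' \<otimes> inv k" .
        moreover have "inv d' \<otimes> d \<in> D" "k' \<otimes> inv k \<in> K"
          using dk D K by (auto simp: subgroup.m_closed subgroup.m_inv_closed)
        ultimately have "inv d' \<otimes> d = \<one>" "k' \<otimes> inv k = \<one>" using DK by auto
        then show "d = d' \<and> k = k'"
          by (metis \<open>d \<in> carrier G\<close> \<open>k \<in> carrier G\<close> \<open>d' \<in> carrier G\<close> \<open>k' \<in> carrier G\<close>
              inv_closed inv_equality inv_inv)
      qed
      show "?h ` carrier (conj_semidirect G D K) = carrier (G Mod N)"
      proof -
        have "N #> x \<in> ?h ` (D \<times> K)" if x: "x \<in> carrier G" for x
        proof -
          obtain d k a where dk: "d \<in> D" "k \<in> K" "a \<in> N" and e: "x = d \<otimes> k \<otimes> a"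
            using x all unfolding set_mult_def by blast
          have [simp]: "d \<in> carrier G" "k \<in> carrier G" "a \<in> carrier G" using cl dk by auto
          have "N #> x = (N #> (d \<otimes> k)) <#> (N #> a)" by (simp add: e N.rcos_sum)
          also have "N #> a = N #> \<one>"
            using dk(3) by (metis N.rcos_const is_group N.subset coset_mult_one)
          also have "(N #> (d \<otimes> k)) <#> (N #> \<one>) = N #> (d \<otimes> k)" by (simp add: N.rcos_sum)
          finally show ?thesis using dk by force
        qed
        moreover have "N #> (d \<otimes> k) \<in> (\<lambda>x. N #> x) ` carrier G" if "d \<in> D" "k \<in> K" for d k
          using that cl by simp
        moreover have "carrier (G Mod N) = (\<lambda>x. N #> x) ` carrier G"
          by (auto simp: FactGroup_def RCOSETS_def)
        ultimately show ?thesis by (auto simp: conj_semidirect_def)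
      qed
    qed
  next
    fix x y assume xy: "x \<in> carrier (conj_semidirect G D K)" "y \<in> carrier (conj_semidirect G D K)"
    obtain d k d' k' where e: "x = (d, k)" "y = (d', k')" by fastforce
    have dk: "d \<in> D" "k \<in> K" "d' \<in> D" "k' \<in> K" using xy e by (auto simp: conj_semidirect_def)
    then have [simp]: "d \<in> carrier G" "k \<in> carrier G" "d' \<in> carrier G" "k' \<in> carrier G"
      using cl by auto
    have "d \<otimes> (k \<otimes> d' \<otimes> inv k) \<otimes> (k \<otimes> k') = d \<otimes> k \<otimes> (d' \<otimes> k')"
      by (simp add: m_assoc inv_cancel)
    then show "x \<otimes>\<^bsub>conj_semidirect G D K\<^esub> y \<in> carrier (conj_semidirect G D K) \<and>
        ?h (x \<otimes>\<^bsub>conj_semidirect G D K\<^esub> y) = ?h x \<otimes>\<^bsub>G Mod N\<^esub> ?h y"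
      using dk conj[of k d'] D K
      by (simp add: conj_semidirect_def e N.rcos_sum subgroup.m_closed)
  qed
qed

section \<open>Automorphisms and inner automorphisms of a group\<close>

context group
begin

lemma carrier_Auto [simp]: "carrier (AutoGroup G) = auto G"
  by (simp add: AutoGroup_def)

lemma Auto_closed [simp]:
  "\<one>\<^bsub>AutoGroup G\<^esub> \<in> auto G"
  "\<phi> \<in> auto G \<Longrightarrow> inv\<^bsub>AutoGroup G\<^esub> \<phi> \<in> auto G"
  "\<phi> \<in> auto G \<Longrightarrow> \<psi> \<in> auto G \<Longrightarrow> \<phi> \<otimes>\<^bsub>AutoGroup G\<^esub> \<psi> \<in> auto G"
  using group.inv_closed[OF AutoGroup] monoid.m_closed[OF group.is_monoid[OF AutoGroup]]
    monoid.one_closed[OF group.is_monoid[OF AutoGroup]]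
  by auto

lemma Auto_mult: "\<phi> \<in> auto G \<Longrightarrow> \<psi> \<in> auto G \<Longrightarrow> \<phi> \<otimes>\<^bsub>AutoGroup G\<^esub> \<psi> = compose (carrier G) \<phi> \<psi>"
  by (simp add: AutoGroup_def BijGroup_def auto_def)

lemma Auto_mult_apply [simp]:
  "\<phi> \<in> auto G \<Longrightarrow> \<psi> \<in> auto G \<Longrightarrow> x \<in> carrier G \<Longrightarrow> (\<phi> \<otimes>\<^bsub>AutoGroup G\<^esub> \<psi>) x = \<phi> (\<psi> x)"
  by (simp add: Auto_mult compose_eq)

lemma Auto_one_apply [simp]: "x \<in> carrier G \<Longrightarrow> \<one>\<^bsub>AutoGroup G\<^esub> x = x"
  by (simp add: AutoGroup_def BijGroup_def)

lemma autoI: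
  "\<phi> \<in> hom G G \<Longrightarrow> bij_betw \<phi> (carrier G) (carrier G) \<Longrightarrow> \<phi> \<in> extensional (carrier G) \<Longrightarrow> \<phi> \<in> auto G"
  by (simp add: auto_def Bij_def)

lemma autoD: "\<phi> \<in> auto G \<Longrightarrow> \<phi> \<in> hom G G"
  and auto_extensional: "\<phi> \<in> auto G \<Longrightarrow> \<phi> \<in> extensional (carrier G)"
  by (simp_all add: auto_def Bij_def)

lemma auto_hom: "\<phi> \<in> auto G \<Longrightarrow> group_hom G G \<phi>"
  by (simp add: auto_def group_hom_def group_hom_axioms_def is_group)

lemma auto_inj: "\<phi> \<in> auto G \<Longrightarrow> x \<in> carrier G \<Longrightarrow> y \<in> carrier G \<Longrightarrow> \<phi> x = \<phi> y \<longleftrightarrow> x = y"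
  by (auto simp: auto_def Bij_def bij_betw_def inj_on_def)

lemma auto_closed: "\<phi> \<in> auto G \<Longrightarrow> x \<in> carrier G \<Longrightarrow> \<phi> x \<in> carrier G"
  by (auto simp: auto_def hom_def)

lemma auto_mult:
  "\<phi> \<in> auto G \<Longrightarrow> x \<in> carrier G \<Longrightarrow> y \<in> carrier G \<Longrightarrow> \<phi> (x \<otimes> y) = \<phi> x \<otimes> \<phi> y"
  by (auto simp: auto_def hom_def)

declare auto_closed [simp] auto_mult [simp]

lemma auto_pow: "\<phi> \<in> auto G \<Longrightarrow> x \<in> carrier G \<Longrightarrow> \<phi> (x [^] (k::nat)) = \<phi> x [^] k"
  by (simp add: group_hom.hom_nat_pow auto_hom)

lemma auto_inv: "\<phi> \<in> auto G \<Longrightarrow> x \<in> carrier G \<Longrightarrow> \<phi> (inv x) = inv (\<phi> x)"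
  by (simp add: group_hom.hom_inv auto_hom)

lemma auto_one [simp]: "\<phi> \<in> auto G \<Longrightarrow> \<phi> \<one> = \<one>"
  by (simp add: group_hom.hom_one auto_hom)

lemma auto_invI:
  assumes "\<phi> \<in> auto G" "x \<in> carrier G" "\<phi> x = y"
  shows "(inv\<^bsub>AutoGroup G\<^esub> \<phi>) y = x"
proof -
  interpret A: group "AutoGroup G" by (rule AutoGroup)
  have "inv\<^bsub>AutoGroup G\<^esub> \<phi> \<in> auto G" using A.inv_closed[of \<phi>] assms(1) by simp
  then have "(inv\<^bsub>AutoGroup G\<^esub> \<phi>) (\<phi> x) = (inv\<^bsub>AutoGroup G\<^esub> \<phi> \<otimes>\<^bsub>AutoGroup G\<^esub> \<phi>) x"
    using assms by (simp only: Auto_mult_apply)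
  then show ?thesis using assms A.l_inv[of \<phi>] by simp
qed

lemma inner_apply: "x \<in> carrier G \<Longrightarrow> inner G g x = g \<otimes> x \<otimes> inv g"
  by (simp add: inner_def)

lemma inner_auto [simp]:
  assumes g: "g \<in> carrier G"
  shows "inner G g \<in> auto G"
proof -
  have inv: "inv g \<otimes> (g \<otimes> x \<otimes> inv g) \<otimes> g = x" "g \<otimes> (inv g \<otimes> x \<otimes> g) \<otimes> inv g = x"
    if "x \<in> carrier G" for x
    using g that by (simp_all add: m_assoc inv_cancel)
  have "inner G g \<in> hom G G"
    using g by (auto intro!: homI simp: inner_def m_assoc inv_cancel)
  moreover have "bij_betw (inner G g) (carrier G) (carrier G)"
    by (rule bij_betw_byWitness[where f' = "\<lambda>x. inv g \<otimes> x \<otimes> g"]) (use g inv in \<open>auto simp: inner_def\<close>)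
  ultimately show ?thesis by (rule autoI) (simp add: inner_def)
qed

lemma auto_eqI:
  "\<phi> \<in> auto G \<Longrightarrow> \<psi> \<in> auto G \<Longrightarrow> (\<And>x. x \<in> carrier G \<Longrightarrow> \<phi> x = \<psi> x) \<Longrightarrow> \<phi> = \<psi>"
  by (rule extensionalityI[of _ "carrier G"]) (auto simp: auto_extensional)

lemma inner_mult:
  assumes "g \<in> carrier G" "h \<in> carrier G"
  shows "inner G g \<otimes>\<^bsub>AutoGroup G\<^esub> inner G h = inner G (g \<otimes> h)"
proof -
  interpret A: group "AutoGroup G" by (rule AutoGroup)
  show ?thesis
  proof (rule auto_eqI)
    show "inner G g \<otimes>\<^bsub>AutoGroup G\<^esub> inner G h \<in> auto G"
      using A.m_closed[of "inner G g" "inner G h"] assms by simp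
  qed (use assms in \<open>auto simp: inner_apply inv_mult_group m_assoc inv_cancel\<close>)
qed

lemma inner_one: "inner G \<one> = \<one>\<^bsub>AutoGroup G\<^esub>"
proof -
  interpret A: group "AutoGroup G" by (rule AutoGroup)
  show ?thesis by (rule auto_eqI) (use A.one_closed in \<open>auto simp: inner_apply\<close>)
qed

lemma inner_inv: "g \<in> carrier G \<Longrightarrow> inv\<^bsub>AutoGroup G\<^esub> inner G g = inner G (inv g)"
proof -
  interpret A: group "AutoGroup G" by (rule AutoGroup)
  assume "g \<in> carrier G"
  then show ?thesis by (intro A.inv_equality) (auto simp: inner_mult inner_one)
qed

lemma Inn_normal: "Inn G \<lhd> AutoGroup G"
proof -
  interpret A: group "AutoGroup G" by (rule AutoGroup)
  have sub: "subgroup (Inn G) (AutoGroup G)"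
  proof (rule A.subgroupI)
    show "Inn G \<subseteq> carrier (AutoGroup G)" "Inn G \<noteq> {}" by (auto simp: Inn_def)
    show "inv\<^bsub>AutoGroup G\<^esub> a \<in> Inn G" if "a \<in> Inn G" for a
      using that by (auto simp: Inn_def inner_inv)
    show "a \<otimes>\<^bsub>AutoGroup G\<^esub> b \<in> Inn G" if "a \<in> Inn G" "b \<in> Inn G" for a b
      using that by (auto simp: Inn_def inner_mult)
  qed
  have "\<phi> \<otimes>\<^bsub>AutoGroup G\<^esub> a \<otimes>\<^bsub>AutoGroup G\<^esub> inv\<^bsub>AutoGroup G\<^esub> \<phi> \<in> Inn G"
    if \<phi>: "\<phi> \<in> auto G" and a: "a \<in> Inn G" for \<phi> a
  proof -
    obtain g where g: "g \<in> carrier G" and ag: "a = inner G g" using a by (auto simp: Inn_def)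
    \<comment> \<open>Conjugating \<open>inner G g\<close> by \<open>\<phi>\<close> gives
      \<open>inner G (\<phi> g)\<close>; stated as an equation of products, it involves no value of
      an inverse automorphism.\<close>
    have "\<phi> \<otimes>\<^bsub>AutoGroup G\<^esub> a = inner G (\<phi> g) \<otimes>\<^bsub>AutoGroup G\<^esub> \<phi>"
    proof (rule auto_eqI)
      show "\<phi> \<otimes>\<^bsub>AutoGroup G\<^esub> a \<in> auto G" "inner G (\<phi> g) \<otimes>\<^bsub>AutoGroup G\<^esub> \<phi> \<in> auto G"
        using A.m_closed[of \<phi> a] A.m_closed[of "inner G (\<phi> g)" \<phi>] \<phi> g ag by auto
    qed (use \<phi> g ag in \<open>auto simp: inner_apply auto_inv\<close>)
    then have "\<phi> \<otimes>\<^bsub>AutoGroup G\<^esub> a \<otimes>\<^bsub>AutoGroup G\<^esub> inv\<^bsub>AutoGroup G\<^esub> \<phi> = inner G (\<phi> g)"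
      using \<phi> g by (simp add: A.m_assoc)
    then show ?thesis using \<phi> g by (auto simp: Inn_def)
  qed
  then show ?thesis using sub by (auto simp: A.normal_inv_iff)
qed

end

section \<open>Automorphisms fixing the distinguished involution\<close>

text \<open>The assumption \<open>extend\<close> is the universal property of the presentation,
  restricted to endomorphisms that fix \<open>s\<close> and send each \<open>r i\<close> to a power
  of a rotation with the same order.\<close>

locale star_group_aut = star_group_nf W I t s r for W (structure) and I :: "'i set" and t s r +
  assumes extend: "(\<And>i. i \<in> I \<Longrightarrow> \<alpha> i \<in> I \<and> t (\<alpha> i) = t i) \<Longrightarrow>
    \<exists>\<phi>\<in>hom W W. \<phi> s = s \<and> (\<forall>i\<in>I. \<phi> (r i) = r (\<alpha> i) [^] (c i :: nat))"
begin

abbreviation A where "A \<equiv> AutoGroup W"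

sublocale A: group A by (rule AutoGroup)

text \<open>Existence of normal forms means that \<open>s\<close> and the \<open>r i\<close>
  generate \<open>W\<close>.\<close>

lemma hom_eq:
  assumes "\<phi> \<in> hom W W" "\<psi> \<in> hom W W" "\<phi> s = \<psi> s" "\<And>i. i \<in> I \<Longrightarrow> \<phi> (r i) = \<psi> (r i)"
    and x: "x \<in> carrier W"
  shows "\<phi> x = \<psi> x"
proof -
  interpret \<phi>: group_hom W W \<phi> using assms by unfold_locales
  interpret \<psi>: group_hom W W \<psi> using assms by unfold_locales
  obtain xs e where xs: "reduced I t xs" and x: "x = rots xs \<otimes> sgn e"
    using nf_ex[OF x] by (auto simp: nf_def)
  have "\<phi> (rots xs) = \<psi> (rots xs)" if "letters xs"
    using that by (induction xs) (auto simp: \<phi>.hom_nat_pow \<psi>.hom_nat_pow assms(4))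
  then show ?thesis
    using reduced_letters[OF xs] assms(3) by (simp add: x sgn_def)
qed

lemma aut_eq:
  assumes "\<phi> \<in> auto W" "\<psi> \<in> auto W" "\<phi> s = \<psi> s" "\<And>i. i \<in> I \<Longrightarrow> \<phi> (r i) = \<psi> (r i)"
  shows "\<phi> = \<psi>"
  using assms(1,2) by (rule auto_eqI) (rule hom_eq[OF autoD autoD], use assms in auto)

text \<open>The same extension principle, applied to the inverse permutation and to inverse
  exponents, yields the inverse map.\<close>

lemma extend_auto:
  assumes \<alpha>: "\<alpha> permutes I" "\<And>i. i \<in> I \<Longrightarrow> t (\<alpha> i) = t i"
    and c: "\<And>i. i \<in> I \<Longrightarrow> coprime (c i) (t i)"
  shows "\<exists>\<phi>\<in>auto W. \<phi> s = s \<and> (\<forall>i\<in>I. \<phi> (r i) = r (\<alpha> i) [^] (c i :: nat))"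
proof -
  let ?\<beta> = "inv_into UNIV \<alpha>"
  have \<alpha>I: "\<alpha> i \<in> I" "?\<beta> i \<in> I" if "i \<in> I" for i
    using that permutes_in_image[OF \<alpha>(1)] permutes_in_image[OF permutes_inv[OF \<alpha>(1)]] by auto
  have inv [simp]: "\<alpha> (?\<beta> i) = i" "?\<beta> (\<alpha> i) = i" for i
    using permutes_inverses[OF \<alpha>(1)] by auto
  have t\<beta>: "t (?\<beta> i) = t i" if "i \<in> I" for i
    using \<alpha>(2)[OF \<alpha>I(2)[OF that]] by simp
  \<comment> \<open>The second map sends \<open>r i\<close> to a power of
    \<open>r (?\<beta> i)\<close>, so the exponent to be inverted is the one at
    \<open>?\<beta> i\<close>, not at \<open>i\<close>.\<close>
  define d where "d i = (SOME y. [c (?\<beta> i) * y = 1] (mod t i))" for i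
  have d: "[c (?\<beta> i) * d i = 1] (mod t i)" if "i \<in> I" for i
  proof -
    have "coprime (c (?\<beta> i)) (t i)" using c[OF \<alpha>I(2)[OF that]] t\<beta>[OF that] by simp
    then have "\<exists>y. [c (?\<beta> i) * y = 1] (mod t i)"
      using cong_solve_coprime_nat[of "c (?\<beta> i)" "t i"] by simp
    then show ?thesis unfolding d_def by (rule someI_ex)
  qed
  obtain \<phi> where \<phi>: "\<phi> \<in> hom W W" "\<phi> s = s" "\<And>i. i \<in> I \<Longrightarrow> \<phi> (r i) = r (\<alpha> i) [^] c i"
    using extend[of \<alpha> c] \<alpha> \<alpha>I by auto
  obtain \<psi> where \<psi>: "\<psi> \<in> hom W W" "\<psi> s = s" "\<And>i. i \<in> I \<Longrightarrow> \<psi> (r i) = r (?\<beta> i) [^] d i"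
    using extend[of ?\<beta> d] t\<beta> \<alpha>I by auto
  interpret \<phi>: group_hom W W \<phi> using \<phi>(1) by unfold_locales
  interpret \<psi>: group_hom W W \<psi> using \<psi>(1) by unfold_locales
  have "(\<phi> \<circ> \<psi>) x = id x" if "x \<in> carrier W" for x
  proof (rule hom_eq[OF _ _ _ _ that])
    show "\<phi> \<circ> \<psi> \<in> hom W W" "id \<in> hom W W" using \<phi>(1) \<psi>(1) by (auto intro: hom_compose homI)
    show "(\<phi> \<circ> \<psi>) (r i) = id (r i)" if "i \<in> I" for i
      using that \<alpha>I(2)[OF that] r_pow_cong[OF that d[OF that]]
      by (simp add: \<phi> \<psi> \<phi>.hom_nat_pow nat_pow_pow)
  qed (simp add: \<phi> \<psi>)
  moreover have "(\<psi> \<circ> \<phi>) x = id x" if "x \<in> carrier W" for x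
  proof (rule hom_eq[OF _ _ _ _ that])
    show "\<psi> \<circ> \<phi> \<in> hom W W" "id \<in> hom W W" using \<phi>(1) \<psi>(1) by (auto intro: hom_compose homI)
    show "(\<psi> \<circ> \<phi>) (r i) = id (r i)" if "i \<in> I" for i
      using that \<alpha>I(1)[OF that] r_pow_cong[OF that, of "c i * d (\<alpha> i)" 1] d[OF \<alpha>I(1)[OF that]] \<alpha>(2)[OF that]
      by (simp add: \<phi> \<psi> \<psi>.hom_nat_pow nat_pow_pow mult.commute)
  qed (simp add: \<phi> \<psi>)
  ultimately have "bij_betw \<phi> (carrier W) (carrier W)"
    by (intro bij_betw_byWitness[of _ \<psi>]) auto
  moreover have "restrict \<phi> (carrier W) \<in> hom W W" by (rule homI) simp_all
  ultimately have "restrict \<phi> (carrier W) \<in> auto W"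
    by (intro autoI) (simp_all add: bij_betw_restrict_eq)
  then show ?thesis
    using \<phi> by (intro bexI[of _ "restrict \<phi> (carrier W)"]) auto
qed

section \<open>The stabiliser of the involution and its subgroups\<close>

definition stab :: "('a \<Rightarrow> 'a) set" where
  "stab = {\<phi> \<in> auto W. \<phi> s = s}"

text \<open>The group \<open>C\<close>, described by its elements instead of generators;
  \<open>Cgrp_eq_diag\<close> makes the identification.\<close>

definition diag :: "('a \<Rightarrow> 'a) set" where
  "diag = {\<phi> \<in> stab. \<forall>i\<in>I. \<exists>a::nat. \<phi> (r i) = r i [^] a}"

text \<open>At most one coordinate differs from 1. For the star group these are exactly the maps
  \<open>theta n t i k\<close>, the identity included.\<close>

definition dilations :: "('a \<Rightarrow> 'a) set" where
  "dilations = {\<phi> \<in> diag. \<exists>i\<in>I. \<forall>j\<in>I. j \<noteq> i \<longrightarrow> \<phi> (r j) = r j}"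

text \<open>The group \<open>G\<close>, with preservation of the blocks expressed as preservation of
  \<open>t\<close>.\<close>

definition graphs :: "('a \<Rightarrow> 'a) set" where
  "graphs = {\<phi> \<in> stab. \<exists>\<alpha>. \<alpha> permutes I \<and> (\<forall>i\<in>I. t (\<alpha> i) = t i \<and> \<phi> (r i) = r (\<alpha> i))}"

lemma stab_auto: "\<phi> \<in> stab \<Longrightarrow> \<phi> \<in> auto W"
  by (simp add: stab_def)

lemma subgroup_stab: "subgroup stab A"
proof (rule A.subgroupI)
  have "\<one>\<^bsub>A\<^esub> \<in> stab" by (simp add: stab_def)
  then show "stab \<noteq> {}" by blast
qed (auto simp: stab_def intro: auto_invI)

lemma diag_stab: "\<phi> \<in> diag \<Longrightarrow> \<phi> \<in> stab" and graphs_stab: "\<phi> \<in> graphs \<Longrightarrow> \<phi> \<in> stab"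
  by (simp_all add: diag_def graphs_def)

text \<open>For \<open>g = gcd a (t i)\<close>, the power of \<open>r i\<close> with exponent
  \<open>t i div g\<close> is sent to \<open>\<one>\<close>; injectivity then forces
  \<open>g = 1\<close>.\<close>

lemma diag_coprime:
  assumes \<phi>: "\<phi> \<in> auto W" and i: "i \<in> I" and "\<phi> (r i) = r i [^] (a::nat)"
  shows "coprime a (t i)"
proof -
  define g where "g = gcd a (t i)"
  have "t i dvd a * (t i div g)"
    unfolding g_def by (metis dvd_div_mult gcd_dvd1 gcd_dvd2 dvd_triv_right div_mult_swap)
  then have "\<phi> (r i [^] (t i div g)) = \<one>"
    using assms by (simp add: auto_pow nat_pow_pow r_pow_eq_one_iff)
  then have "\<phi> (r i [^] (t i div g)) = \<phi> \<one>" using \<phi> by simp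
  then have "r i [^] (t i div g) = \<one>" using \<phi> i by (simp only: auto_inj nat_pow_closed r_closed one_closed)
  then have "t i dvd t i div g" using i by (simp add: r_pow_eq_one_iff)
  moreover have "0 < g" "g dvd t i" using t_ge[OF i] by (auto simp: g_def intro!: Nat.gr0I)
  ultimately have "t i * g dvd t i" by (simp add: dvd_div_iff_mult)
  then have "g = 1" using t_ge[OF i] by (auto dest!: dvd_imp_le)
  then show ?thesis by (simp add: g_def coprime_iff_gcd_eq_1)
qed

lemma diag_inv:
  assumes \<phi>: "\<phi> \<in> diag" and i: "i \<in> I" and a: "\<phi> (r i) = r i [^] (a::nat)"
  obtains b where "[a * b = 1] (mod t i)" "(inv\<^bsub>A\<^esub> \<phi>) (r i) = r i [^] b"
proof -
  have "\<phi> \<in> auto W" using \<phi> by (simp add: diag_def stab_def)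
  then have "coprime a (t i)" using diag_coprime i a by blast
  then obtain b where b: "[a * b = 1] (mod t i)" using cong_solve_coprime_nat[of a "t i"] by auto
  have "\<phi> (r i [^] b) = r i"
    using \<open>\<phi> \<in> auto W\<close> i a r_pow_cong[OF i b] by (simp add: auto_pow nat_pow_pow)
  then show ?thesis using that[OF b] auto_invI[OF \<open>\<phi> \<in> auto W\<close>, of "r i [^] b"] i by simp
qed

lemma subgroup_diag: "subgroup diag A"
proof (rule A.subgroupI)
  show "diag \<subseteq> carrier A" by (auto simp: diag_def stab_def)
  have "\<one>\<^bsub>A\<^esub> \<in> diag"
    using subgroup.one_closed[OF subgroup_stab]
    by (auto simp: diag_def intro!: exI[of _ "1::nat"])
  then show "diag \<noteq> {}" by blast
next
  fix \<phi> assume \<phi>: "\<phi> \<in> diag"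
  have "\<exists>b::nat. (inv\<^bsub>A\<^esub> \<phi>) (r i) = r i [^] b" if i: "i \<in> I" for i
  proof -
    obtain a :: nat where "\<phi> (r i) = r i [^] a" using \<phi> i by (auto simp: diag_def)
    then show ?thesis using diag_inv[OF \<phi> i] by blast
  qed
  then show "inv\<^bsub>A\<^esub> \<phi> \<in> diag"
    using subgroup.m_inv_closed[OF subgroup_stab diag_stab[OF \<phi>]] by (simp add: diag_def)
next
  fix \<phi> \<psi> assume "\<phi> \<in> diag" "\<psi> \<in> diag"
  then have m: "\<phi> \<in> stab" "\<psi> \<in> stab" "\<phi> \<in> auto W" "\<psi> \<in> auto W"
    and e: "\<And>i. i \<in> I \<Longrightarrow> \<exists>a::nat. \<phi> (r i) = r i [^] a" "\<And>i. i \<in> I \<Longrightarrow> \<exists>a::nat. \<psi> (r i) = r i [^] a"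
    by (auto simp: diag_def stab_def)
  have "\<exists>a::nat. (\<phi> \<otimes>\<^bsub>A\<^esub> \<psi>) (r i) = r i [^] a" if i: "i \<in> I" for i
  proof -
    obtain a b :: nat where "\<phi> (r i) = r i [^] a" "\<psi> (r i) = r i [^] b" using e[OF i] by blast
    then have "(\<phi> \<otimes>\<^bsub>A\<^esub> \<psi>) (r i) = r i [^] (a * b)" using m i by (simp add: auto_pow nat_pow_pow)
    then show ?thesis by blast
  qed
  then show "\<phi> \<otimes>\<^bsub>A\<^esub> \<psi> \<in> diag"
    using subgroup.m_closed[OF subgroup_stab m(1,2)] by (simp add: diag_def)
qed

lemma dilation_exists:
  assumes "i \<in> I" "coprime c (t i)"
  shows "\<exists>\<phi>\<in>dilations. \<phi> (r i) = r i [^] (c::nat) \<and> (\<forall>j\<in>I. j \<noteq> i \<longrightarrow> \<phi> (r j) = r j)"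
proof -
  define d where "d j = (if j = i then c else 1)" for j
  have "coprime (d j) (t j)" if "j \<in> I" for j using assms by (simp add: d_def)
  then obtain \<phi> where \<phi>: "\<phi> \<in> auto W" "\<phi> s = s" "\<And>j. j \<in> I \<Longrightarrow> \<phi> (r j) = r j [^] d j"
    using extend_auto[OF permutes_id, of d] by auto
  have "\<phi> \<in> diag" using \<phi> by (auto simp: diag_def stab_def)
  moreover have "\<phi> (r i) = r i [^] c" "\<And>j. j \<in> I \<Longrightarrow> j \<noteq> i \<Longrightarrow> \<phi> (r j) = r j"
    using \<phi>(3) assms(1) by (auto simp: d_def)
  ultimately show ?thesis using assms(1) by (intro bexI[of _ \<phi>]) (auto simp: dilations_def)
qed

text \<open>Induction on a finite set \<open>S\<close> outside which \<open>\<phi>\<close> fixes the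
  rotations: composing with the inverse of one dilation removes an index from
  \<open>S\<close>.\<close>

lemma generate_dilations: "generate A dilations = diag"
proof
  show "generate A dilations \<subseteq> diag"
    by (rule A.generate_subgroup_incl[OF _ subgroup_diag]) (auto simp: dilations_def)
  have "\<phi> \<in> generate A dilations"
    if "finite S" "S \<subseteq> I" "\<phi> \<in> diag" "\<And>i. i \<in> I - S \<Longrightarrow> \<phi> (r i) = r i" for S \<phi>
    using that
  proof (induction S arbitrary: \<phi> rule: finite_induct)
    case empty
    then have "\<phi> = \<one>\<^bsub>A\<^esub>" by (intro aut_eq) (auto simp: diag_def stab_def)
    then show ?case by (simp add: generate.one)
  next
    case (insert i S)
    have i: "i \<in> I" and S: "S \<subseteq> I" using insert.prems by auto
    have \<phi>: "\<phi> \<in> auto W" using insert.prems by (simp add: diag_def stab_def)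
    obtain c :: nat where c: "\<phi> (r i) = r i [^] c" using insert.prems i by (auto simp: diag_def)
    obtain \<theta> where \<theta>: "\<theta> \<in> dilations" "\<theta> (r i) = r i [^] c" "\<And>j. j \<in> I \<Longrightarrow> j \<noteq> i \<Longrightarrow> \<theta> (r j) = r j"
      using dilation_exists[OF i diag_coprime[OF \<phi> i c]] by blast
    have \<theta>d: "\<theta> \<in> diag" "\<theta> \<in> auto W" using \<theta>(1) by (auto simp: dilations_def diag_def stab_def)
    let ?\<psi> = "inv\<^bsub>A\<^esub> \<theta> \<otimes>\<^bsub>A\<^esub> \<phi>"
    have "?\<psi> (r j) = r j" if j: "j \<in> I - S" for j
    proof (cases "j = i")
      case True
      then show ?thesis using i \<phi> \<theta>d c \<theta>(2) auto_invI[OF \<theta>d(2), of "r i"] by simp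
    next
      case False
      then show ?thesis
        using j \<phi> \<theta>d insert.prems(3)[of j] \<theta>(3)[of j] auto_invI[OF \<theta>d(2), of "r j"] by simp
    qed
    moreover have "?\<psi> \<in> diag"
      using \<theta>d insert.prems(2) subgroup_diag by (simp add: subgroup.m_closed subgroup.m_inv_closed)
    ultimately have "?\<psi> \<in> generate A dilations" using insert.IH S by blast
    then have "\<theta> \<otimes>\<^bsub>A\<^esub> ?\<psi> \<in> generate A dilations" by (rule generate.eng[OF generate.incl[OF \<theta>(1)]])
    then show ?case using \<theta>d \<phi> by (simp add: A.inv_cancel)
  qed
  from this[OF fin] show "diag \<subseteq> generate A dilations" by auto
qed

lemma subgroup_graphs: "subgroup graphs A"
proof (rule A.subgroupI)
  show "graphs \<subseteq> carrier A" by (auto simp: graphs_def stab_def)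
  have "\<one>\<^bsub>A\<^esub> \<in> graphs"
    using subgroup.one_closed[OF subgroup_stab]
    by (auto simp: graphs_def intro!: exI[of _ id] permutes_id)
  then show "graphs \<noteq> {}" by blast
next
  fix \<phi> assume "\<phi> \<in> graphs"
  then obtain \<alpha> where \<phi>: "\<phi> \<in> stab" and \<alpha>: "\<alpha> permutes I"
    and e: "\<And>i. i \<in> I \<Longrightarrow> t (\<alpha> i) = t i \<and> \<phi> (r i) = r (\<alpha> i)"
    by (auto simp: graphs_def)
  let ?\<beta> = "inv_into UNIV \<alpha>"
  have "t (?\<beta> i) = t i \<and> (inv\<^bsub>A\<^esub> \<phi>) (r i) = r (?\<beta> i)" if "i \<in> I" for i
  proof -
    have "?\<beta> i \<in> I" "\<alpha> (?\<beta> i) = i"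
      using that permutes_in_image[OF permutes_inv[OF \<alpha>]] permutes_inverses[OF \<alpha>] by auto
    then show ?thesis using e[of "?\<beta> i"] auto_invI[OF stab_auto[OF \<phi>]] by simp
  qed
  then show "inv\<^bsub>A\<^esub> \<phi> \<in> graphs"
    using subgroup.m_inv_closed[OF subgroup_stab \<phi>] permutes_inv[OF \<alpha>] by (auto simp: graphs_def)
next
  fix \<phi> \<psi> assume "\<phi> \<in> graphs" "\<psi> \<in> graphs"
  then obtain \<alpha> \<beta> where \<phi>: "\<phi> \<in> stab" and \<alpha>: "\<alpha> permutes I"
    and e: "\<And>i. i \<in> I \<Longrightarrow> t (\<alpha> i) = t i \<and> \<phi> (r i) = r (\<alpha> i)"
    and \<psi>: "\<psi> \<in> stab" and \<beta>: "\<beta> permutes I"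
    and f: "\<And>i. i \<in> I \<Longrightarrow> t (\<beta> i) = t i \<and> \<psi> (r i) = r (\<beta> i)"
    by (auto simp: graphs_def)
  have "t ((\<alpha> \<circ> \<beta>) i) = t i \<and> (\<phi> \<otimes>\<^bsub>A\<^esub> \<psi>) (r i) = r ((\<alpha> \<circ> \<beta>) i)" if "i \<in> I" for i
  proof -
    have "\<beta> i \<in> I" using that permutes_in_image[OF \<beta>] by simp
    then show ?thesis using e[of "\<beta> i"] f[OF that] stab_auto[OF \<phi>] stab_auto[OF \<psi>] that by simp
  qed
  then show "\<phi> \<otimes>\<^bsub>A\<^esub> \<psi> \<in> graphs"
    using subgroup.m_closed[OF subgroup_stab \<phi> \<psi>] permutes_compose[OF \<beta> \<alpha>] unfolding graphs_def by blast
qed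

text \<open>Here \<open>r (\<alpha> i)\<close> is a power of \<open>r i\<close>; since it is
  nontrivial, it belongs to the same index.\<close>

lemma diag_graphs_trivial: "\<phi> \<in> diag \<Longrightarrow> \<phi> \<in> graphs \<Longrightarrow> \<phi> = \<one>\<^bsub>A\<^esub>"
proof -
  assume d: "\<phi> \<in> diag" and "\<phi> \<in> graphs"
  then obtain \<alpha> where \<phi>: "\<phi> \<in> stab" and \<alpha>: "\<alpha> permutes I" and e: "\<And>i. i \<in> I \<Longrightarrow> \<phi> (r i) = r (\<alpha> i)"
    by (auto simp: graphs_def)
  have "\<phi> (r i) = r i" if i: "i \<in> I" for i
  proof -
    obtain a :: nat where "\<phi> (r i) = r i [^] a" using d i by (auto simp: diag_def)
    then have "r (\<alpha> i) [^] (1::nat) = r i [^] a"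
      using e[OF i] permutes_in_image[OF \<alpha>, of i] i by simp
    then have "\<alpha> i = i"
      using r_pow_eq_iff[of "\<alpha> i" i 1 a] permutes_in_image[OF \<alpha>, of i] i t_ge[of "\<alpha> i"]
      by (auto split: if_splits)
    then show ?thesis using e[OF i] by simp
  qed
  then show "\<phi> = \<one>\<^bsub>A\<^esub>" using \<phi> by (intro aut_eq) (auto simp: stab_def)
qed

text \<open>\<open>r i \<otimes> s\<close> is an involution whose product with \<open>s\<close> has
  finite order. Both properties survive an automorphism fixing \<open>s\<close>, so
  \<open>involution_finite_order\<close> applies to the image.\<close>

lemma stab_rotation:
  assumes \<phi>: "\<phi> \<in> stab" and i: "i \<in> I"
  obtains j a where "j \<in> I" "\<phi> (r i) = r j [^] (a::nat)"
proof -
  note [simp] = stab_auto[OF \<phi>]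
  have \<phi>s [simp]: "\<phi> s = s" using \<phi> by (simp add: stab_def)
  have [simp]: "r i \<in> carrier W" using i by simp
  let ?x = "r i \<otimes> s"
  have xC: "?x \<in> carrier W" by simp
  have "?x \<otimes> ?x = r i \<otimes> (s \<otimes> r i \<otimes> s)" by (simp add: m_assoc)
  then have xx: "?x \<otimes> ?x = \<one>" using s_r[OF i] by simp
  \<comment> \<open>The product is trivial only if \<open>r i = s\<close>, but then
    \<open>r i\<close> has square \<open>\<one>\<close>, while its order \<open>t i\<close> is at
    least 3.\<close>
  have x1: "?x \<noteq> \<one>"
  proof
    assume "?x = \<one>"
    then have "r i = s" using inv_equality[of "r i" s] i by simp
    then have "r i [^] (2::nat) = \<one>" using s_s by (simp add: numeral_2_eq_2)
    then show False using r_pow_eq_one_iff[OF i, of 2] t_ge[OF i] by (auto dest: dvd_imp_le)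
  qed
  have x: "\<phi> ?x \<otimes> \<phi> ?x = \<one>" "\<phi> ?x \<noteq> \<one>"
    using auto_mult[OF stab_auto[OF \<phi>] xC xC] auto_inj[OF stab_auto[OF \<phi>] xC one_closed] x1
      auto_one[OF stab_auto[OF \<phi>]]
    unfolding xx by (metis, metis)
  have xs: "\<phi> ?x \<otimes> s = \<phi> (r i)" by (simp add: m_assoc)
  have "(\<phi> ?x \<otimes> s) [^] t i = \<one>" unfolding xs using r_order[OF i] by (simp add: auto_pow[symmetric])
  moreover have "\<phi> ?x \<in> carrier W" "0 < t i" using t_ge[OF i] by simp_all
  ultimately show ?thesis
    using involution_finite_order[of "\<phi> ?x" "t i"] x that unfolding xs by blast
qed

text \<open>Applying \<open>stab_rotation\<close> to \<open>\<phi>\<close> and to its inverse shows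
  that the cyclic subgroups are permuted: going forth and back returns to the same index, and the
  orders divide each other.\<close>

lemma stab_permutation:
  assumes \<phi>: "\<phi> \<in> stab"
  shows "\<exists>\<alpha>. \<alpha> permutes I \<and> (\<forall>i\<in>I. t (\<alpha> i) = t i \<and> (\<exists>a::nat. \<phi> (r i) = r (\<alpha> i) [^] a))"
proof -
  note \<phi>a [simp] = stab_auto[OF \<phi>]
  \<comment> \<open>Going forth and back writes \<open>r i\<close> as a power of \<open>r j\<close>,
    and a nontrivial power determines its index.\<close>
  have unique: "i = j" if "\<psi> \<in> auto W" "i \<in> I" "j \<in> I" "k \<in> I" "\<psi> (r i) = r k [^] (a::nat)" "(inv\<^bsub>A\<^esub> \<psi>) (r k) = r j [^] (b::nat)"
    for \<psi> i j k a b
  proof -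
    have "r i = (inv\<^bsub>A\<^esub> \<psi>) (r k [^] a)" using that auto_invI[of \<psi> "r i"] by simp
    also have "\<dots> = r j [^] (b * a)" using that by (simp add: auto_pow nat_pow_pow)
    finally have "r i [^] (1::nat) = r j [^] (b * a)" using that by simp
    then show ?thesis using that t_ge[of i] r_pow_eq_iff[of i j 1 "b * a"] by (auto split: if_splits)
  qed
  have dvd: "t i dvd t j" if "\<psi> \<in> auto W" "i \<in> I" "j \<in> I" "\<psi> (r i) = r j [^] (a::nat)" for \<psi> i j a
  proof -
    have "\<psi> (r i [^] t j) = \<psi> \<one>"
      using that by (simp add: auto_pow nat_pow_pow r_pow_eq_one_iff)
    then have "r i [^] t j = \<one>" using that by (simp only: auto_inj nat_pow_closed r_closed one_closed)
    then show ?thesis using that by (simp add: r_pow_eq_one_iff)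
  qed
  define \<sigma> where "\<sigma> i = (SOME j. j \<in> I \<and> (\<exists>a::nat. \<phi> (r i) = r j [^] a))" for i
  have sig: "\<sigma> i \<in> I \<and> (\<exists>a::nat. \<phi> (r i) = r (\<sigma> i) [^] a)" if i: "i \<in> I" for i
  proof -
    obtain j a where "j \<in> I" "\<phi> (r i) = r j [^] (a::nat)" by (rule stab_rotation[OF \<phi> i])
    then have "\<exists>j. j \<in> I \<and> (\<exists>a::nat. \<phi> (r i) = r j [^] a)" by blast
    then show ?thesis unfolding \<sigma>_def by (rule someI_ex)
  qed
  note \<sigma> = conjunct1[OF sig] conjunct2[OF sig]
  have bwd: "(\<exists>b::nat. (inv\<^bsub>A\<^esub> \<phi>) (r (\<sigma> i)) = r i [^] b)" if i: "i \<in> I" for i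
  proof -
    obtain j b where j: "j \<in> I" "(inv\<^bsub>A\<^esub> \<phi>) (r (\<sigma> i)) = r j [^] (b::nat)"
      by (rule stab_rotation[OF subgroup.m_inv_closed[OF subgroup_stab \<phi>] \<sigma>(1)[OF i]])
    obtain a :: nat where "\<phi> (r i) = r (\<sigma> i) [^] a" using \<sigma>(2)[OF i] by blast
    then have "i = j" by (rule unique[OF \<phi>a i j(1) \<sigma>(1)[OF i] _ j(2)])
    then show ?thesis using j(2) by blast
  qed
  have t\<sigma>: "t (\<sigma> i) = t i" if i: "i \<in> I" for i
  proof -
    obtain a b :: nat where "\<phi> (r i) = r (\<sigma> i) [^] a" "(inv\<^bsub>A\<^esub> \<phi>) (r (\<sigma> i)) = r i [^] b"
      using \<sigma>(2)[OF i] bwd[OF i] by blast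
    then have "t i dvd t (\<sigma> i)" "t (\<sigma> i) dvd t i"
      using dvd[OF \<phi>a i \<sigma>(1)[OF i]] dvd[OF Auto_closed(2)[OF \<phi>a] \<sigma>(1)[OF i] i] by blast+
    then show ?thesis by (rule dvd_antisym[rotated])
  qed
  have "inj_on \<sigma> I"
  proof (rule inj_onI)
    fix i j assume i: "i \<in> I" and j: "j \<in> I" and "\<sigma> i = \<sigma> j"
    then obtain a b :: nat where "\<phi> (r i) = r (\<sigma> i) [^] a" "(inv\<^bsub>A\<^esub> \<phi>) (r (\<sigma> i)) = r j [^] b"
      using \<sigma>(2)[OF i] bwd[OF j] by auto
    then show "i = j" by (rule unique[OF \<phi>a i j \<sigma>(1)[OF i]])
  qed
  then have "\<sigma> ` I = I" using \<sigma>(1) by (intro endo_inj_surj[OF fin]) auto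
  \<comment> \<open>\<open>permutes\<close> requires the identity outside \<open>I\<close>, where
    the choice \<open>\<sigma>\<close> is uncontrolled.\<close>
  define \<alpha> where "\<alpha> i = (if i \<in> I then \<sigma> i else i)" for i
  have "bij_betw \<alpha> I I"
    using \<open>inj_on \<sigma> I\<close> \<open>\<sigma> ` I = I\<close> by (auto simp: bij_betw_def \<alpha>_def inj_on_def)
  then have "\<alpha> permutes I" by (rule bij_imp_permutes) (simp add: \<alpha>_def)
  then show ?thesis using t\<sigma> \<sigma>(2) by (intro exI[of _ \<alpha>]) (simp add: \<alpha>_def)
qed

text \<open>Take for \<open>\<gamma>\<close> the graph automorphism with the permutation induced by
  \<open>\<phi>\<close>; composing \<open>\<phi>\<close> with its inverse sends each
  \<open>r j\<close> to a power of itself.\<close>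

lemma stab_decomp:
  assumes \<phi>: "\<phi> \<in> stab"
  obtains \<delta> \<gamma> where "\<delta> \<in> diag" "\<gamma> \<in> graphs" "\<phi> = \<delta> \<otimes>\<^bsub>A\<^esub> \<gamma>"
proof -
  obtain \<alpha> where \<alpha>: "\<alpha> permutes I" "\<And>i. i \<in> I \<Longrightarrow> t (\<alpha> i) = t i"
    and a: "\<And>i. i \<in> I \<Longrightarrow> \<exists>a::nat. \<phi> (r i) = r (\<alpha> i) [^] a"
    using stab_permutation[OF \<phi>] by blast
  obtain \<gamma> where \<gamma>: "\<gamma> \<in> auto W" "\<gamma> s = s" "\<forall>i\<in>I. \<gamma> (r i) = r (\<alpha> i) [^] (1::nat)"
    using extend_auto[OF \<alpha>, of "\<lambda>_. 1"] by (metis coprime_1_left)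
  have \<alpha>I: "\<alpha> i \<in> I" if "i \<in> I" for i using that permutes_in_image[OF \<alpha>(1)] by auto
  have \<gamma>r: "\<gamma> (r i) = r (\<alpha> i)" if "i \<in> I" for i using \<gamma> \<alpha>I[OF that] that by simp
  have g: "\<gamma> \<in> graphs" using \<alpha> \<gamma>(1,2) \<gamma>r unfolding graphs_def stab_def by blast
  have "\<exists>b::nat. (\<phi> \<otimes>\<^bsub>A\<^esub> inv\<^bsub>A\<^esub> \<gamma>) (r j) = r j [^] b" if "j \<in> I" for j
  proof -
    have "j \<in> \<alpha> ` I" unfolding permutes_image[OF \<alpha>(1)] by (rule that)
    then obtain i where i: "i \<in> I" "j = \<alpha> i" by (rule imageE)
    have "(inv\<^bsub>A\<^esub> \<gamma>) (r j) = r i"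
      unfolding i(2) by (rule auto_invI[OF \<gamma>(1) r_closed[OF i(1)] \<gamma>r[OF i(1)]])
    then have "(\<phi> \<otimes>\<^bsub>A\<^esub> inv\<^bsub>A\<^esub> \<gamma>) (r j) = \<phi> (r i)"
      using stab_auto[OF \<phi>] \<gamma>(1) that by simp
    then show ?thesis using a[OF i(1)] i(2) by simp
  qed
  moreover have "\<phi> \<otimes>\<^bsub>A\<^esub> inv\<^bsub>A\<^esub> \<gamma> \<in> stab"
    using \<phi> graphs_stab[OF g] subgroup_stab by (simp add: subgroup.m_closed subgroup.m_inv_closed)
  ultimately have "\<phi> \<otimes>\<^bsub>A\<^esub> inv\<^bsub>A\<^esub> \<gamma> \<in> diag" by (simp add: diag_def)
  then show ?thesis using that[OF _ g] stab_auto[OF \<phi>] \<gamma>(1) by (simp add: A.m_assoc)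
qed

end

section \<open>The complement\<close>

text \<open>The power with exponent \<open>(p - 1) div 2\<close> is the quadratic character modulo
  \<open>p\<close>, and \<open>m - 1\<close> represents -1. That exponent is odd, so -1 has
  character -1 and multiplication by it exchanges residues and nonresidues.\<close>

lemma half_power_cong:
  fixes p m :: nat
  assumes p: "Factorial_Ring.prime p" "p mod 4 = 3" and m: "p dvd m" "0 < m"
  shows "\<not> [(m - 1) ^ ((p - 1) div 2) = 1] (mod p)"
    and "\<not> p dvd c \<Longrightarrow> \<not> [c ^ ((p - 1) div 2) = 1] (mod p) \<Longrightarrow> [(c * (m - 1)) ^ ((p - 1) div 2) = 1] (mod p)"
proof -
  define q where "q = (p - 1) div 2"
  have q: "odd q" "p - 1 = 2 * q" using p(2) unfolding q_def by presburger+
  have p3: "3 \<le> p" using p(2) by (metis mod_less_eq_dividend)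
  have "[int (m - 1) = - 1] (mod int p)"
    using m by (simp add: cong_iff_dvd_diff of_nat_diff)
  then have "[int (m - 1) ^ q = (- 1) ^ q] (mod int p)" by (rule cong_pow)
  then have m1: "[int ((m - 1) ^ q) = - 1] (mod int p)" using q(1) by simp
  show "\<not> [(m - 1) ^ q = 1] (mod p)"
  proof
    assume "[(m - 1) ^ q = 1] (mod p)"
    then have "[int ((m - 1) ^ q) = 1] (mod int p)" by (metis cong_int_iff of_nat_1)
    then have "[- 1 = (1::int)] (mod int p)" using m1 by (metis cong_sym cong_trans)
    then have "int p dvd 2" by (simp add: cong_iff_dvd_diff)
    then show False using p3 by (auto dest: zdvd_imp_le)
  qed
  assume c: "\<not> p dvd c" and n: "\<not> [c ^ q = 1] (mod p)"
  have "[c ^ (2 * q) = 1] (mod p)" using fermat_theorem[OF p(1) c] q(2) by simp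
  then have "[int (c ^ (2 * q)) = 1] (mod int p)" by (metis cong_int_iff of_nat_1)
  \<comment> \<open>Fermat makes \<open>c ^ (2 * q)\<close> congruent to 1; the difference of
    squares leaves only 1 and -1 for \<open>c ^ q\<close>.\<close>
  then have "int p dvd (int c ^ q - 1) * (int c ^ q + 1)"
    by (simp add: cong_iff_dvd_diff algebra_simps mult_2_right power_add)
  moreover have "\<not> int p dvd int c ^ q - 1"
  proof
    assume "int p dvd int c ^ q - 1"
    then have "[int (c ^ q) = int 1] (mod int p)" by (simp add: cong_iff_dvd_diff)
    then show False using n by (simp only: cong_int_iff)
  qed
  ultimately have "int p dvd int c ^ q + 1"
    using p(1) by (simp add: prime_dvd_mult_iff)
  then have "[int (c ^ q) = - 1] (mod int p)" by (simp add: cong_iff_dvd_diff)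
  from cong_mult[OF this m1] have "[int ((c * (m - 1)) ^ q) = int 1] (mod int p)"
    by (simp add: power_mult_distrib)
  then show "[(c * (m - 1)) ^ q = 1] (mod p)" by (simp only: cong_int_iff)
qed

section \<open>Inner automorphisms in the stabiliser, and the complement\<close>

context star_group_aut
begin

text \<open>The coordinate -1 is represented by the natural number \<open>t i - 1\<close>.\<close>

lemma inner_s_r: "i \<in> I \<Longrightarrow> inner W s (r i) = r i [^] (t i - 1)"
  using s_r[of i] inv_r_pow[of i 1] t_ge[of i] by (simp add: inner_apply)

lemma inner_s_stab: "inner W s \<in> stab"
  by (simp add: stab_def inner_apply)

lemma inner_s_diag: "inner W s \<in> diag"
  using inner_s_stab inner_s_r by (auto simp: diag_def)

lemma generate_inner_s: "generate A {inner W s} = {\<one>\<^bsub>A\<^esub>, inner W s}"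
proof
  have sq: "inner W s \<otimes>\<^bsub>A\<^esub> inner W s = \<one>\<^bsub>A\<^esub>"
    by (simp add: inner_mult inner_one)
  have "subgroup {\<one>\<^bsub>A\<^esub>, inner W s} A"
    by (rule A.subgroupI) (auto simp: sq inner_inv)
  then show "generate A {inner W s} \<subseteq> {\<one>\<^bsub>A\<^esub>, inner W s}"
    by (rule A.generate_subgroup_incl[rotated]) simp
  show "{\<one>\<^bsub>A\<^esub>, inner W s} \<subseteq> generate A {inner W s}"
    by (auto intro: generate.one generate.incl)
qed

text \<open>Conjugation by \<open>g\<close> fixes \<open>s\<close> only if \<open>g\<close>
  centralises \<open>s\<close>.\<close>

lemma Inn_stab:
  assumes "\<phi> \<in> Inn W" "\<phi> \<in> stab"
  shows "\<phi> = \<one>\<^bsub>A\<^esub> \<or> \<phi> = inner W s"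
proof -
  obtain g where g: "g \<in> carrier W" "\<phi> = inner W g" using assms(1) by (auto simp: Inn_def)
  then have e: "g \<otimes> s \<otimes> inv g = s" using assms(2) by (simp add: stab_def inner_apply)
  have "g \<otimes> s = (g \<otimes> s \<otimes> inv g) \<otimes> g" using g(1) by (simp add: m_assoc)
  then have "g \<otimes> s = s \<otimes> g" unfolding e .
  then show ?thesis using centralizer_s[OF g(1)] g(2) inner_one by auto
qed

text \<open>The image of \<open>s\<close> is again an involution, hence a conjugate of
  \<open>s\<close>; undoing that conjugation leaves an element of \<open>stab\<close>.\<close>

lemma auto_Inn_stab:
  assumes \<phi>: "\<phi> \<in> auto W"
  obtains \<iota> \<psi> where "\<iota> \<in> Inn W" "\<psi> \<in> stab" "\<phi> = \<iota> \<otimes>\<^bsub>A\<^esub> \<psi>"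
proof -
  have x: "\<phi> s \<in> carrier W" using \<phi> by simp
  have "\<phi> s \<otimes> \<phi> s = \<one>"
    using auto_mult[OF \<phi> s_closed s_closed] auto_one[OF \<phi>] unfolding s_s by (metis)
  moreover have "\<phi> s \<noteq> \<one>"
    using auto_inj[OF \<phi> s_closed one_closed] s_ne_one auto_one[OF \<phi>] by metis
  ultimately obtain g where g: "g \<in> carrier W" "\<phi> s = g \<otimes> s \<otimes> inv g"
    by (rule involution_conj_s[OF x])
  let ?\<psi> = "inv\<^bsub>A\<^esub> inner W g \<otimes>\<^bsub>A\<^esub> \<phi>"
  have "(inv\<^bsub>A\<^esub> inner W g) (\<phi> s) = s"
    by (rule auto_invI) (use g in \<open>simp_all add: inner_apply\<close>)
  then have "?\<psi> \<in> stab" using \<phi> g(1) by (simp add: stab_def)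
  moreover have "\<phi> = inner W g \<otimes>\<^bsub>A\<^esub> ?\<psi>" using \<phi> g(1) by (simp add: A.inv_cancel)
  ultimately show ?thesis using that g(1) by (auto simp: Inn_def)
qed

text \<open>Conjugation by \<open>\<gamma>\<close> transports the exponent of
  \<open>\<delta>\<close> at \<open>i\<close> to the index \<open>j\<close> with
  \<open>\<gamma> (r i) = r j\<close>. The second claim is the case of a fixed index, as needed for
  \<open>half_diag\<close>.\<close>

lemma graphs_conj_diag:
  assumes \<gamma>: "\<gamma> \<in> graphs" and \<delta>: "\<delta> \<in> diag"
  shows "\<gamma> \<otimes>\<^bsub>A\<^esub> \<delta> \<otimes>\<^bsub>A\<^esub> inv\<^bsub>A\<^esub> \<gamma> \<in> diag"
    and "i \<in> I \<Longrightarrow> \<gamma> (r i) = r i \<Longrightarrow> \<delta> (r i) = r i [^] (a::nat) \<Longrightarrow>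
      (\<gamma> \<otimes>\<^bsub>A\<^esub> \<delta> \<otimes>\<^bsub>A\<^esub> inv\<^bsub>A\<^esub> \<gamma>) (r i) = r i [^] a"
proof -
  note \<gamma>a = stab_auto[OF graphs_stab[OF \<gamma>]] and \<delta>a = stab_auto[OF diag_stab[OF \<delta>]]
  have conj: "(\<gamma> \<otimes>\<^bsub>A\<^esub> \<delta> \<otimes>\<^bsub>A\<^esub> inv\<^bsub>A\<^esub> \<gamma>) (r j) = r j [^] a"
    if i: "i \<in> I" "j \<in> I" "\<gamma> (r i) = r j" "\<delta> (r i) = r i [^] (a::nat)" for i j a
  proof -
    have "(inv\<^bsub>A\<^esub> \<gamma>) (r j) = r i" by (rule auto_invI[OF \<gamma>a r_closed[OF i(1)] i(3)])
    then have "(\<gamma> \<otimes>\<^bsub>A\<^esub> \<delta> \<otimes>\<^bsub>A\<^esub> inv\<^bsub>A\<^esub> \<gamma>) (r j) = \<gamma> (\<delta> (r i))"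
      using \<gamma>a \<delta>a i(1,2) by simp
    also have "\<dots> = r j [^] a" using i \<gamma>a by (simp add: auto_pow)
    finally show ?thesis .
  qed
  then show "i \<in> I \<Longrightarrow> \<gamma> (r i) = r i \<Longrightarrow> \<delta> (r i) = r i [^] (a::nat) \<Longrightarrow>
      (\<gamma> \<otimes>\<^bsub>A\<^esub> \<delta> \<otimes>\<^bsub>A\<^esub> inv\<^bsub>A\<^esub> \<gamma>) (r i) = r i [^] a" by blast
  obtain \<alpha> where \<alpha>: "\<alpha> permutes I" and e: "\<And>i. i \<in> I \<Longrightarrow> \<gamma> (r i) = r (\<alpha> i)"
    using \<gamma> by (auto simp: graphs_def)
  have "\<exists>a::nat. (\<gamma> \<otimes>\<^bsub>A\<^esub> \<delta> \<otimes>\<^bsub>A\<^esub> inv\<^bsub>A\<^esub> \<gamma>) (r j) = r j [^] a" if j: "j \<in> I" for j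
  proof -
    have "j \<in> \<alpha> ` I" unfolding permutes_image[OF \<alpha>] by (rule j)
    then obtain i where i: "i \<in> I" "j = \<alpha> i" by (rule imageE)
    obtain a :: nat where "\<delta> (r i) = r i [^] a" using \<delta> i(1) unfolding diag_def by blast
    then show ?thesis using conj[OF i(1) j] e[OF i(1)] i(2) by blast
  qed
  moreover have "\<gamma> \<otimes>\<^bsub>A\<^esub> \<delta> \<otimes>\<^bsub>A\<^esub> inv\<^bsub>A\<^esub> \<gamma> \<in> stab"
    using graphs_stab[OF \<gamma>] diag_stab[OF \<delta>] subgroup_stab
    by (simp add: subgroup.m_closed subgroup.m_inv_closed)
  ultimately show "\<gamma> \<otimes>\<^bsub>A\<^esub> \<delta> \<otimes>\<^bsub>A\<^esub> inv\<^bsub>A\<^esub> \<gamma> \<in> diag" by (simp add: diag_def)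
qed

text \<open>For an odd prime \<open>p\<close> dividing \<open>t i\<close>, the exponent at
  \<open>i\<close> must be a square modulo \<open>p\<close>, phrased by Euler's criterion. By
  \<open>half_diag_iff\<close> the choice of \<open>c\<close> is immaterial.\<close>

definition half_diag :: "'i \<Rightarrow> nat \<Rightarrow> ('a \<Rightarrow> 'a) set" where
  "half_diag i p = {\<phi> \<in> diag. \<exists>c. \<phi> (r i) = r i [^] c \<and> [c ^ ((p - 1) div 2) = 1] (mod p)}"

text \<open>An exponent of \<open>r i\<close> is determined modulo \<open>t i\<close>, hence modulo
  its divisor \<open>p\<close>, so one representative decides membership.\<close>

lemma half_diag_iff:
  assumes "i \<in> I" "p dvd t i" "\<phi> \<in> diag" "\<phi> (r i) = r i [^] (c::nat)"
  shows "\<phi> \<in> half_diag i p \<longleftrightarrow> [c ^ ((p - 1) div 2) = 1] (mod p)"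
proof -
  have "[c ^ ((p - 1) div 2) = d ^ ((p - 1) div 2)] (mod p)" if "r i [^] c = r i [^] (d::nat)" for d
    using that assms(1,2) r_pow_eq_iff[of i i c d] by (intro cong_pow) (auto intro: cong_dvd_modulus_nat)
  then show ?thesis
    using assms(3,4) unfolding half_diag_def by (auto intro: cong_trans cong_sym)
qed

lemma subgroup_half_diag:
  assumes i: "i \<in> I" and p: "p dvd t i"
  shows "subgroup (half_diag i p) A"
proof (rule A.subgroupI)
  show "half_diag i p \<subseteq> carrier A" by (auto simp: half_diag_def diag_def stab_def)
  have "\<one>\<^bsub>A\<^esub> \<in> half_diag i p"
    using half_diag_iff[OF i p, of "\<one>\<^bsub>A\<^esub>" 1] subgroup.one_closed[OF subgroup_diag] i by simp
  then show "half_diag i p \<noteq> {}" by blast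
next
  fix \<phi> assume "\<phi> \<in> half_diag i p"
  then obtain c where \<phi>: "\<phi> \<in> diag" "\<phi> (r i) = r i [^] c" and c: "[c ^ ((p - 1) div 2) = 1] (mod p)"
    by (auto simp: half_diag_def)
  obtain b where b: "[c * b = 1] (mod t i)" "(inv\<^bsub>A\<^esub> \<phi>) (r i) = r i [^] b"
    using diag_inv[OF \<phi>(1) i \<phi>(2)] .
  have "[c * b = 1] (mod p)" using b(1) p by (rule cong_dvd_modulus_nat)
  then have "[(c * b) ^ ((p - 1) div 2) = 1 ^ ((p - 1) div 2)] (mod p)" by (rule cong_pow)
  then have "[c ^ ((p - 1) div 2) * b ^ ((p - 1) div 2) = 1] (mod p)"
    by (simp add: power_mult_distrib)
  moreover have "[c ^ ((p - 1) div 2) * b ^ ((p - 1) div 2) = 1 * b ^ ((p - 1) div 2)] (mod p)"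
    using c by (rule cong_scalar_right)
  ultimately have "[b ^ ((p - 1) div 2) = 1] (mod p)" by (metis cong_sym cong_trans mult_1)
  then show "inv\<^bsub>A\<^esub> \<phi> \<in> half_diag i p"
    using half_diag_iff[OF i p subgroup.m_inv_closed[OF subgroup_diag \<phi>(1)] b(2)] by simp
next
  fix \<phi> \<psi> assume "\<phi> \<in> half_diag i p" "\<psi> \<in> half_diag i p"
  then obtain c d where \<phi>: "\<phi> \<in> diag" "\<phi> (r i) = r i [^] c" and c: "[c ^ ((p - 1) div 2) = 1] (mod p)"
    and \<psi>: "\<psi> \<in> diag" "\<psi> (r i) = r i [^] d" and d: "[d ^ ((p - 1) div 2) = 1] (mod p)"
    by (auto simp: half_diag_def)
  have "(\<phi> \<otimes>\<^bsub>A\<^esub> \<psi>) (r i) = r i [^] (c * d)"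
    using i \<phi>(2) \<psi>(2) stab_auto[OF diag_stab[OF \<phi>(1)]] stab_auto[OF diag_stab[OF \<psi>(1)]]
    by (simp add: auto_pow nat_pow_pow)
  moreover have "[(c * d) ^ ((p - 1) div 2) = 1] (mod p)"
    using cong_mult[OF c d] by (simp add: power_mult_distrib)
  ultimately show "\<phi> \<otimes>\<^bsub>A\<^esub> \<psi> \<in> half_diag i p"
    using half_diag_iff[OF i p subgroup.m_closed[OF subgroup_diag \<phi>(1) \<psi>(1)]] by blast
qed

text \<open>Every automorphism is a product of an inner one, an element of \<open>D\<close>, a power
  of \<open>inner W s\<close> and a graph automorphism; normality of \<open>Inn W\<close> collects
  the inner factors on the right.\<close>

lemma Out_split:
  assumes i: "i \<in> I" and unique: "\<And>j. j \<in> I \<Longrightarrow> t j = t i \<Longrightarrow> j = i"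
    and p: "Factorial_Ring.prime p" "p mod 4 = 3" "p dvd t i"
  defines "D \<equiv> half_diag i p"
  shows "subgroup D A" and "D \<subseteq> diag"
    and "D \<inter> generate A {inner W s} = {\<one>\<^bsub>A\<^esub>}"
    and "diag = D <#>\<^bsub>A\<^esub> generate A {inner W s}"
    and "\<forall>g\<in>graphs. (\<lambda>d. g \<otimes>\<^bsub>A\<^esub> d \<otimes>\<^bsub>A\<^esub> inv\<^bsub>A\<^esub> g) ` D = D"
    and "subgroup (D <#>\<^bsub>A\<^esub> graphs) A"
    and "(D <#>\<^bsub>A\<^esub> graphs) \<inter> Inn W = {\<one>\<^bsub>A\<^esub>}"
    and "(D <#>\<^bsub>A\<^esub> graphs) <#>\<^bsub>A\<^esub> Inn W = carrier A"
    and "Out W \<cong> conj_semidirect A D graphs"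
proof -
  have t0: "0 < t i" using t_ge[OF i] by simp
  have ps: "\<not> [(t i - 1) ^ ((p - 1) div 2) = 1] (mod p)"
    by (rule half_power_cong(1)[OF p t0])
  show D: "subgroup D A" unfolding D_def by (rule subgroup_half_diag[OF i p(3)])
  show D_diag: "D \<subseteq> diag" by (auto simp: D_def half_diag_def)
  have Da: "d \<in> auto W" if "d \<in> D" for d using that subgroup.mem_carrier[OF D] by simp
  have ga: "g \<in> auto W" if "g \<in> graphs" for g by (rule stab_auto[OF graphs_stab[OF that]])
  have s_notin: "inner W s \<notin> D"
    unfolding D_def using half_diag_iff[OF i p(3) inner_s_diag inner_s_r[OF i]] ps by simp
  have one: "\<one>\<^bsub>A\<^esub> \<in> D" by (rule subgroup.one_closed[OF D])
  show "D \<inter> generate A {inner W s} = {\<one>\<^bsub>A\<^esub>}"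
    unfolding generate_inner_s using s_notin one by blast
  show diag: "diag = D <#>\<^bsub>A\<^esub> generate A {inner W s}"
  proof
    show "D <#>\<^bsub>A\<^esub> generate A {inner W s} \<subseteq> diag"
      using D_diag inner_s_diag subgroup.m_closed[OF subgroup_diag] subgroup.one_closed[OF subgroup_diag]
      unfolding set_mult_def generate_inner_s by blast
    show "diag \<subseteq> D <#>\<^bsub>A\<^esub> generate A {inner W s}"
    proof
      fix \<phi> assume \<phi>: "\<phi> \<in> diag"
      note \<phi>a = stab_auto[OF diag_stab[OF \<phi>]]
      obtain c :: nat where c: "\<phi> (r i) = r i [^] c" using \<phi> i unfolding diag_def by blast
      show "\<phi> \<in> D <#>\<^bsub>A\<^esub> generate A {inner W s}"
      proof (cases "\<phi> \<in> D")
        case True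
        have "\<phi> = \<phi> \<otimes>\<^bsub>A\<^esub> \<one>\<^bsub>A\<^esub>" using \<phi>a by simp
        then show ?thesis using True unfolding set_mult_def generate_inner_s by blast
      next
        case False
        have "coprime c (t i)" by (rule diag_coprime[OF \<phi>a i c])
        then have "\<not> p dvd c" using p(1,3) by (meson coprime_common_divisor not_prime_unit)
        moreover have "\<not> [c ^ ((p - 1) div 2) = 1] (mod p)"
          using False half_diag_iff[OF i p(3) \<phi> c] by (simp add: D_def)
        ultimately have cong: "[(c * (t i - 1)) ^ ((p - 1) div 2) = 1] (mod p)"
          by (rule half_power_cong(2)[OF p t0])
        \<comment> \<open>The exponent at \<open>i\<close> is a nonresidue here; composing with
          \<open>inner W s\<close> multiplies it by -1 and moves the element into
          \<open>D\<close>.\<close>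
        let ?\<psi> = "\<phi> \<otimes>\<^bsub>A\<^esub> inner W s"
        have "?\<psi> (r i) = r i [^] (c * (t i - 1))"
          using \<phi>a i c inner_s_r[OF i] by (simp add: auto_pow nat_pow_pow)
        then have "?\<psi> \<in> D"
          using half_diag_iff[OF i p(3) subgroup.m_closed[OF subgroup_diag \<phi> inner_s_diag]] cong
          by (simp add: D_def)
        moreover have "\<phi> = ?\<psi> \<otimes>\<^bsub>A\<^esub> inner W s"
          using \<phi>a by (simp add: A.m_assoc inner_mult inner_one)
        ultimately show ?thesis unfolding set_mult_def generate_inner_s by blast
      qed
    qed
  qed
  have conj: "g \<otimes>\<^bsub>A\<^esub> d \<otimes>\<^bsub>A\<^esub> inv\<^bsub>A\<^esub> g \<in> D" if g: "g \<in> graphs" and d: "d \<in> D" for g d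
  proof -
    have dd: "d \<in> diag" using d D_diag by blast
    obtain \<alpha> where \<alpha>: "\<alpha> permutes I" "\<And>i. i \<in> I \<Longrightarrow> t (\<alpha> i) = t i" "\<And>i. i \<in> I \<Longrightarrow> g (r i) = r (\<alpha> i)"
      using g unfolding graphs_def by blast
    \<comment> \<open>Graph automorphisms preserve \<open>t\<close>, and \<open>i\<close> is the
      only index with its value.\<close>
    have "\<alpha> i = i" using unique[of "\<alpha> i"] \<alpha>(2)[OF i] permutes_in_image[OF \<alpha>(1)] i by simp
    then have gi: "g (r i) = r i" using \<alpha>(3)[OF i] by simp
    obtain c :: nat where c: "d (r i) = r i [^] c" using dd i unfolding diag_def by blast
    then have "[c ^ ((p - 1) div 2) = 1] (mod p)" using d half_diag_iff[OF i p(3) dd c] by (simp add: D_def)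
    then show ?thesis
      using half_diag_iff[OF i p(3) graphs_conj_diag(1)[OF g dd] graphs_conj_diag(2)[OF g dd i gi c]]
      by (simp add: D_def)
  qed
  show "\<forall>g\<in>graphs. (\<lambda>d. g \<otimes>\<^bsub>A\<^esub> d \<otimes>\<^bsub>A\<^esub> inv\<^bsub>A\<^esub> g) ` D = D"
  proof (intro ballI equalityI)
    fix g assume g: "g \<in> graphs"
    show "(\<lambda>d. g \<otimes>\<^bsub>A\<^esub> d \<otimes>\<^bsub>A\<^esub> inv\<^bsub>A\<^esub> g) ` D \<subseteq> D" using conj[OF g] by blast
    show "D \<subseteq> (\<lambda>d. g \<otimes>\<^bsub>A\<^esub> d \<otimes>\<^bsub>A\<^esub> inv\<^bsub>A\<^esub> g) ` D"
    proof
      fix d assume d: "d \<in> D"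
      have g': "inv\<^bsub>A\<^esub> g \<in> graphs" by (rule subgroup.m_inv_closed[OF subgroup_graphs g])
      have "d = g \<otimes>\<^bsub>A\<^esub> (inv\<^bsub>A\<^esub> g \<otimes>\<^bsub>A\<^esub> d \<otimes>\<^bsub>A\<^esub> inv\<^bsub>A\<^esub> (inv\<^bsub>A\<^esub> g)) \<otimes>\<^bsub>A\<^esub> inv\<^bsub>A\<^esub> g"
        using ga[OF g] Da[OF d] by (simp add: A.m_assoc A.inv_cancel)
      then show "d \<in> (\<lambda>d. g \<otimes>\<^bsub>A\<^esub> d \<otimes>\<^bsub>A\<^esub> inv\<^bsub>A\<^esub> g) ` D"
        using conj[OF g' d] by (rule image_eqI)
    qed
  qed
  show "subgroup (D <#>\<^bsub>A\<^esub> graphs) A"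
    by (rule A.subgroup_set_mult_normalised[OF D subgroup_graphs conj])
  then interpret DG: subgroup "D <#>\<^bsub>A\<^esub> graphs" A .
  interpret N: normal "Inn W" A by (rule Inn_normal)
  have DG_I: "d \<otimes>\<^bsub>A\<^esub> g \<in> D <#>\<^bsub>A\<^esub> graphs" if "d \<in> D" "g \<in> graphs" for d g
    using that unfolding set_mult_def by blast
  have triv: "D \<inter> graphs = {\<one>\<^bsub>A\<^esub>}"
    using diag_graphs_trivial D_diag one subgroup.one_closed[OF subgroup_graphs] by blast
  show DGN: "(D <#>\<^bsub>A\<^esub> graphs) \<inter> Inn W = {\<one>\<^bsub>A\<^esub>}"
  proof
    show "(D <#>\<^bsub>A\<^esub> graphs) \<inter> Inn W \<subseteq> {\<one>\<^bsub>A\<^esub>}"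
    proof
      fix x assume x: "x \<in> (D <#>\<^bsub>A\<^esub> graphs) \<inter> Inn W"
      then obtain d g where dg: "d \<in> D" "g \<in> graphs" and e: "x = d \<otimes>\<^bsub>A\<^esub> g"
        unfolding set_mult_def by blast
      have dd: "d \<in> diag" using dg D_diag by blast
      \<comment> \<open>Both factors fix \<open>s\<close>, so the inner automorphism
        \<open>x\<close> is the identity or \<open>inner W s\<close>. Either way \<open>x\<close> is
        diagonal, which forces \<open>g\<close> to be trivial and puts \<open>x\<close> into
        \<open>D\<close>.\<close>
      have "x \<in> stab"
        unfolding e using subgroup.m_closed[OF subgroup_stab diag_stab[OF dd] graphs_stab[OF dg(2)]] .
      then have x1: "x = \<one>\<^bsub>A\<^esub> \<or> x = inner W s" using Inn_stab x by blast
      then have xd: "x \<in> diag" using inner_s_diag subgroup.one_closed[OF subgroup_diag] by blast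
      have "g = inv\<^bsub>A\<^esub> d \<otimes>\<^bsub>A\<^esub> x" using Da[OF dg(1)] ga[OF dg(2)] by (simp add: e A.inv_cancel)
      then have "g \<in> diag"
        using subgroup.m_closed[OF subgroup_diag subgroup.m_inv_closed[OF subgroup_diag dd] xd] by simp
      then have "g = \<one>\<^bsub>A\<^esub>" using diag_graphs_trivial dg(2) by blast
      then have "x = d" using e Da[OF dg(1)] by simp
      then show "x \<in> {\<one>\<^bsub>A\<^esub>}" using x1 s_notin dg(1) by auto
    qed
    show "{\<one>\<^bsub>A\<^esub>} \<subseteq> (D <#>\<^bsub>A\<^esub> graphs) \<inter> Inn W" by simp
  qed
  show all: "(D <#>\<^bsub>A\<^esub> graphs) <#>\<^bsub>A\<^esub> Inn W = carrier A"
  proof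
    show "(D <#>\<^bsub>A\<^esub> graphs) <#>\<^bsub>A\<^esub> Inn W \<subseteq> carrier A"
      by (rule A.set_mult_closed[OF DG.subset N.subset])
    show "carrier A \<subseteq> (D <#>\<^bsub>A\<^esub> graphs) <#>\<^bsub>A\<^esub> Inn W"
    proof
      fix \<phi> assume "\<phi> \<in> carrier A"
      then have "\<phi> \<in> auto W" by simp
      then obtain \<iota> \<psi> where \<iota>: "\<iota> \<in> Inn W" and \<psi>: "\<psi> \<in> stab" and \<phi>: "\<phi> = \<iota> \<otimes>\<^bsub>A\<^esub> \<psi>"
        by (rule auto_Inn_stab)
      obtain \<delta> g where \<delta>: "\<delta> \<in> diag" and g: "g \<in> graphs" and \<psi>e: "\<psi> = \<delta> \<otimes>\<^bsub>A\<^esub> g"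
        using stab_decomp[OF \<psi>] .
      obtain d z where d: "d \<in> D" and z: "z = \<one>\<^bsub>A\<^esub> \<or> z = inner W s" and \<delta>e: "\<delta> = d \<otimes>\<^bsub>A\<^esub> z"
        using \<delta> unfolding diag generate_inner_s set_mult_def by blast
      have zN: "z \<in> Inn W" using z N.one_closed unfolding Inn_def by auto
      have [simp]: "\<iota> \<in> auto W" "z \<in> auto W" "d \<in> auto W" "g \<in> auto W"
        using N.mem_carrier \<iota> zN Da[OF d] ga[OF g] by simp_all
      \<comment> \<open>The product of \<open>\<iota>\<close>, \<open>d\<close>, \<open>z\<close>,
        \<open>g\<close> is rewritten as \<open>?x\<close> followed by conjugates of
        \<open>\<iota>\<close> and \<open>z\<close>, which remain inner.\<close>
      let ?x = "d \<otimes>\<^bsub>A\<^esub> g"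
      have "inv\<^bsub>A\<^esub> ?x \<otimes>\<^bsub>A\<^esub> \<iota> \<otimes>\<^bsub>A\<^esub> ?x \<in> Inn W" "inv\<^bsub>A\<^esub> g \<otimes>\<^bsub>A\<^esub> z \<otimes>\<^bsub>A\<^esub> g \<in> Inn W"
        using N.inv_op_closed1 \<iota> zN by simp_all
      then have "(inv\<^bsub>A\<^esub> ?x \<otimes>\<^bsub>A\<^esub> \<iota> \<otimes>\<^bsub>A\<^esub> ?x) \<otimes>\<^bsub>A\<^esub> (inv\<^bsub>A\<^esub> g \<otimes>\<^bsub>A\<^esub> z \<otimes>\<^bsub>A\<^esub> g) \<in> Inn W"
        by (rule N.m_closed)
      moreover have "\<phi> = ?x \<otimes>\<^bsub>A\<^esub> ((inv\<^bsub>A\<^esub> ?x \<otimes>\<^bsub>A\<^esub> \<iota> \<otimes>\<^bsub>A\<^esub> ?x) \<otimes>\<^bsub>A\<^esub> (inv\<^bsub>A\<^esub> g \<otimes>\<^bsub>A\<^esub> z \<otimes>\<^bsub>A\<^esub> g))"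
        by (simp add: \<phi> \<psi>e \<delta>e A.m_assoc A.inv_cancel A.inv_mult_group)
      ultimately show "\<phi> \<in> (D <#>\<^bsub>A\<^esub> graphs) <#>\<^bsub>A\<^esub> Inn W"
        using DG_I[OF d g] unfolding set_mult_def by blast
    qed
  qed
  show "Out W \<cong> conj_semidirect A D graphs"
    unfolding Out_def
    by (rule A.Mod_iso_conj_semidirect[OF Inn_normal D subgroup_graphs conj triv DGN all])
qed

end

section \<open>The presented group\<close>

lemma pres_eq_append:
  assumes "pres_eq R u v" "pres_eq R u' v'"
  shows "pres_eq R (u @ u') (v @ v')"
  using pres_eq.app[OF assms(1), of "[]" u'] pres_eq.app[OF assms(2), of v "[]"]
  by (auto intro: pres_eq.trans)

lemma words_append [simp]: "xs @ ys \<in> words n \<longleftrightarrow> xs \<in> words n \<and> ys \<in> words n"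
  and words_Nil [simp]: "[] \<in> words n"
  and words_Cons [simp]: "j # xs \<in> words n \<longleftrightarrow> j \<in> {1..n} \<and> xs \<in> words n"
  by (auto simp: words_def)

lemma pres_class_eqI: "pres_eq R xs ys \<Longrightarrow> pres_class n R xs = pres_class n R ys"
  unfolding pres_class_def by (blast intro: pres_eq.trans pres_eq.sym)

lemma pres_class_some:
  assumes "xs \<in> words n"
  shows "(SOME ys. ys \<in> pres_class n R xs) \<in> words n"
    and "pres_eq R xs (SOME ys. ys \<in> pres_class n R xs)"
proof -
  have "xs \<in> pres_class n R xs" using assms by (simp add: pres_class_def pres_eq.refl)
  then have "(SOME ys. ys \<in> pres_class n R xs) \<in> pres_class n R xs" by (rule someI)
  then show "(SOME ys. ys \<in> pres_class n R xs) \<in> words n"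
    "pres_eq R xs (SOME ys. ys \<in> pres_class n R xs)"
    by (simp_all add: pres_class_def)
qed

lemma carrier_pres_group: "carrier (pres_group n R) = pres_class n R ` words n"
  and one_pres_group: "\<one>\<^bsub>pres_group n R\<^esub> = pres_class n R []"
  by (simp_all add: pres_group_def)

lemma mult_pres_group:
  assumes "xs \<in> words n" "ys \<in> words n"
  shows "pres_class n R xs \<otimes>\<^bsub>pres_group n R\<^esub> pres_class n R ys = pres_class n R (xs @ ys)"
  unfolding pres_group_def monoid.simps
  by (rule pres_class_eqI[OF pres_eq_append[OF pres_eq.sym[OF pres_class_some(2)[OF assms(1)]]
        pres_eq.sym[OF pres_class_some(2)[OF assms(2)]]]])

text \<open>Each letter is its own inverse, so the reversed word represents the inverse.\<close>

lemma group_pres_group: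
  assumes inv: "\<And>j. j \<in> {1..n} \<Longrightarrow> ([j, j], []) \<in> R"
  shows "group (pres_group n R)"
proof (rule groupI)
  fix x assume "x \<in> carrier (pres_group n R)"
  then obtain xs where xs: "xs \<in> words n" "x = pres_class n R xs" by (auto simp: carrier_pres_group)
  have "pres_eq R (rev xs @ xs) []"
    using xs(1)
  proof (induction xs)
    case (Cons j xs)
    have "([j, j], []) \<in> R" using Cons.prems inv by simp
    then have "pres_eq R ([j, j] @ xs) ([] @ xs)"
      by (rule pres_eq_append[OF pres_eq.base pres_eq.refl])
    then have "pres_eq R (rev xs @ ([j, j] @ xs)) (rev xs @ ([] @ xs))"
      by (rule pres_eq_append[OF pres_eq.refl])
    then show ?case using Cons by (auto intro: pres_eq.trans)
  qed (simp add: pres_eq.refl)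
  moreover have "rev xs \<in> words n" using xs(1) by (simp add: words_def)
  ultimately show "\<exists>y\<in>carrier (pres_group n R). y \<otimes>\<^bsub>pres_group n R\<^esub> x = \<one>\<^bsub>pres_group n R\<^esub>"
    using xs by (auto simp: carrier_pres_group one_pres_group mult_pres_group intro!: pres_class_eqI)
qed (auto simp: carrier_pres_group one_pres_group mult_pres_group)

section \<open>The universal property of the presentation\<close>

definition (in monoid) eval_word :: "(nat \<Rightarrow> 'a) \<Rightarrow> nat list \<Rightarrow> 'a" where
  "eval_word f w = foldr (\<lambda>j g. f j \<otimes> g) w \<one>"

context group
begin

lemma eval_word_simps [simp]:
  "eval_word f [] = \<one>" "eval_word f (j # w) = f j \<otimes> eval_word f w"
  by (simp_all add: eval_word_def)

lemma eval_word_closed [simp]: "range f \<subseteq> carrier G \<Longrightarrow> eval_word f w \<in> carrier G"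
  by (induction w) auto

lemma eval_word_append:
  "range f \<subseteq> carrier G \<Longrightarrow> eval_word f (u @ v) = eval_word f u \<otimes> eval_word f v"
  by (induction u) (auto simp: m_assoc range_subsetD)

lemma eval_word_replicate:
  "range f \<subseteq> carrier G \<Longrightarrow> eval_word f (concat (replicate k w)) = eval_word f w [^] k"
  by (induction k) (simp_all add: eval_word_append nat_pow_Suc2[symmetric] del: nat_pow_Suc)

lemma eval_word_pres_eq:
  assumes f: "range f \<subseteq> carrier G" and R: "\<And>u v. (u, v) \<in> R \<Longrightarrow> eval_word f u = eval_word f v"
  shows "pres_eq R u v \<Longrightarrow> eval_word f u = eval_word f v"
  by (induction rule: pres_eq.induct) (simp_all add: R eval_word_append f)

lemma pres_group_hom:
  assumes f: "range f \<subseteq> carrier G" and R: "\<And>u v. (u, v) \<in> R \<Longrightarrow> eval_word f u = eval_word f v"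
  shows "\<exists>\<phi>\<in>hom (pres_group n R) G. \<forall>j\<in>{1..n}. \<phi> (pres_class n R [j]) = f j"
proof -
  \<comment> \<open>The value is taken at a chosen representative; \<open>eval_word_pres_eq\<close>
    makes it independent of the choice.\<close>
  define \<phi> where "\<phi> U = eval_word f (SOME w. w \<in> U)" for U :: "nat list set"
  have \<phi>: "\<phi> (pres_class n R w) = eval_word f w" if "w \<in> words n" for w
    unfolding \<phi>_def using eval_word_pres_eq[OF f R pres_class_some(2)[OF that]] by simp
  have "\<phi> \<in> hom (pres_group n R) G"
    by (rule homI) (auto simp: carrier_pres_group mult_pres_group \<phi> f eval_word_append)
  moreover have "f j \<in> carrier G" for j using f by blast
  ultimately show ?thesis by (intro bexI[of _ \<phi>]) (auto simp: \<phi>)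
qed

lemma star_group_hom:
  assumes f: "\<And>j. j \<in> {1..n} \<Longrightarrow> f j \<in> carrier G"
    and inv: "\<And>j. j \<in> {1..n} \<Longrightarrow> f j \<otimes> f j = \<one>"
    and ord: "\<And>i. i \<in> {2..n} \<Longrightarrow> (f 1 \<otimes> f i) [^] t i = \<one>"
  shows "\<exists>\<phi>\<in>hom (star_group n t) G. \<forall>j\<in>{1..n}. \<phi> (gen n t j) = f j"
proof -
  \<comment> \<open>The congruence \<open>pres_eq\<close> may pass through words with letters
    outside \<open>{1..n}\<close>, so the assignment needs a value in the group there as
    well.\<close>
  define f' where "f' j = (if j \<in> {1..n} then f j else \<one>)" for j
  have f': "range f' \<subseteq> carrier G" using f by (auto simp: f'_def)
  have "\<exists>\<phi>\<in>hom (pres_group n (star_rels n t)) G. \<forall>j\<in>{1..n}. \<phi> (pres_class n (star_rels n t) [j]) = f' j"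
  proof (rule pres_group_hom[OF f'])
    fix u v assume "(u, v) \<in> star_rels n t"
    then consider j where "j \<in> {1..n}" "u = [j, j]" "v = []"
      | i where "i \<in> {2..n}" "u = concat (replicate (t i) [1, i])" "v = []"
      by (auto simp: star_rels_def)
    then show "eval_word f' u = eval_word f' v"
    proof cases
      case 1
      then show ?thesis using f inv by (simp add: f'_def)
    next
      case 2
      then show ?thesis using f ord[of i] by (simp add: eval_word_replicate[OF f'] del: One_nat_def) (simp add: f'_def)
    qed
  qed
  then show ?thesis by (simp add: star_group_def gen_def f'_def)
qed

end

section \<open>Generators and rotations of the star group\<close>

lemma group_star_group: "group (star_group n t)"
  unfolding star_group_def by (rule group_pres_group) (auto simp: star_rels_def)

lemma gen_closed: "j \<in> {1..n} \<Longrightarrow> gen n t j \<in> carrier (star_group n t)"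
  by (auto simp: gen_def star_group_def carrier_pres_group)

lemma star_group_induct [consumes 1, case_names one mult]:
  assumes "g \<in> carrier (star_group n t)"
    and "P \<one>\<^bsub>star_group n t\<^esub>"
    and "\<And>j g. j \<in> {1..n} \<Longrightarrow> g \<in> carrier (star_group n t) \<Longrightarrow> P g \<Longrightarrow> P (gen n t j \<otimes>\<^bsub>star_group n t\<^esub> g)"
  shows "P g"
proof -
  obtain w where w: "w \<in> words n" "g = pres_class n (star_rels n t) w"
    using assms(1) by (auto simp: star_group_def carrier_pres_group)
  have "P (pres_class n (star_rels n t) w)"
    using w(1)
  proof (induction w)
    case Nil
    then show ?case using assms(2) by (simp add: star_group_def one_pres_group)
  next
    case (Cons j w)
    then have "P (gen n t j \<otimes>\<^bsub>star_group n t\<^esub> pres_class n (star_rels n t) w)"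
      by (intro assms(3)) (auto simp: star_group_def carrier_pres_group)
    then show ?case using Cons.prems by (simp add: gen_def star_group_def mult_pres_group)
  qed
  then show ?thesis using w by simp
qed

definition rho :: "nat \<Rightarrow> (nat \<Rightarrow> nat) \<Rightarrow> nat \<Rightarrow> nat list set" where
  "rho n t i = gen n t 1 \<otimes>\<^bsub>star_group n t\<^esub> gen n t i"

lemma gen_square:
  "j \<in> {1..n} \<Longrightarrow> gen n t j \<otimes>\<^bsub>star_group n t\<^esub> gen n t j = \<one>\<^bsub>star_group n t\<^esub>"
  unfolding gen_def star_group_def one_pres_group
  by (subst mult_pres_group) (auto simp: star_rels_def intro!: pres_class_eqI pres_eq.base)

lemma rho_order:
  assumes "i \<in> {2..n}"
  shows "rho n t i [^]\<^bsub>star_group n t\<^esub> t i = \<one>\<^bsub>star_group n t\<^esub>"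
proof -
  interpret group "star_group n t" by (rule group_star_group)
  have "rho n t i [^]\<^bsub>star_group n t\<^esub> k = pres_class n (star_rels n t) (concat (replicate k [1, i]))
      \<and> concat (replicate k [1, i]) \<in> words n" for k
  proof (induction k)
    case 0
    then show ?case by (simp add: star_group_def one_pres_group)
  next
    case (Suc k)
    have r: "rho n t i = pres_class n (star_rels n t) [1, i]"
      using assms by (simp add: rho_def gen_def star_group_def mult_pres_group)
    have "rho n t i [^]\<^bsub>star_group n t\<^esub> Suc k = rho n t i \<otimes>\<^bsub>star_group n t\<^esub> rho n t i [^]\<^bsub>star_group n t\<^esub> k"
      using assms by (intro nat_pow_Suc2) (simp add: rho_def gen_closed)
    also have "\<dots> = pres_class n (star_rels n t) ([1, i] @ concat (replicate k [1, i]))"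
      using Suc assms unfolding r star_group_def by (subst mult_pres_group[symmetric]) auto
    finally show ?case using Suc assms by auto
  qed
  then show ?thesis
    using assms by (auto simp: star_group_def one_pres_group star_rels_def intro!: pres_class_eqI pres_eq.base)
qed

lemma star_rel_star_group:
  assumes n: "1 \<le> n" and t: "\<And>i. i \<in> {2..n} \<Longrightarrow> 3 \<le> t i"
  shows "star_rel (star_group n t) {2..n} t (gen n t 1) (rho n t)"
proof -
  interpret group "star_group n t" by (rule group_star_group)
  have [simp]: "gen n t j \<in> carrier (star_group n t)" if "j \<in> {1..n}" for j using gen_closed[OF that] .
  show ?thesis
  proof unfold_locales
    fix i assume i: "i \<in> {2..n}"
    show "3 \<le> t i" by (rule t[OF i])
    show r: "rho n t i \<in> carrier (star_group n t)" using i n by (simp add: rho_def)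
    show "rho n t i [^]\<^bsub>star_group n t\<^esub> t i = \<one>\<^bsub>star_group n t\<^esub>" by (rule rho_order[OF i])
    have "inv\<^bsub>star_group n t\<^esub> gen n t j = gen n t j" if "j \<in> {1..n}" for j
      using that gen_square[OF that] by (intro inv_equality) auto
    then have "inv\<^bsub>star_group n t\<^esub> rho n t i = gen n t i \<otimes>\<^bsub>star_group n t\<^esub> gen n t 1"
      using i n by (simp add: rho_def inv_mult_group)
    also have "\<dots> = gen n t 1 \<otimes>\<^bsub>star_group n t\<^esub> rho n t i \<otimes>\<^bsub>star_group n t\<^esub> gen n t 1"
      using i n gen_square[of 1 n t] by (simp add: rho_def m_assoc[symmetric])
    finally show "gen n t 1 \<otimes>\<^bsub>star_group n t\<^esub> rho n t i \<otimes>\<^bsub>star_group n t\<^esub> gen n t 1 =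
      inv\<^bsub>star_group n t\<^esub> rho n t i" by simp
  qed (use n gen_square in auto)
qed

lemma gen_eq_s_rho:
  assumes "1 \<le> n" "i \<in> {2..n}"
  shows "gen n t i = gen n t 1 \<otimes>\<^bsub>star_group n t\<^esub> rho n t i"
proof -
  interpret group "star_group n t" by (rule group_star_group)
  show ?thesis
    using assms gen_square[of 1 n t] by (simp add: rho_def m_assoc[symmetric] gen_closed)
qed

text \<open>The state \<open>(xs, e)\<close> stands for \<open>nf xs e\<close>. The generator
  \<open>j\<close> is \<open>s\<close> for \<open>j = 1\<close> and \<open>s\<close> times the
  rotation \<open>j\<close> otherwise, so every generator negates the word and flips the
  sign.\<close>

definition state_act :: "nat \<Rightarrow> (nat \<Rightarrow> nat) \<Rightarrow> nat \<Rightarrow> (nat \<times> nat) list \<times> bool \<Rightarrow> (nat \<times> nat) list \<times> bool" where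
  "state_act n t j = (\<lambda>(xs, e)\<in>{xs. reduced {2..n} t xs} \<times> UNIV.
     (neg t (if j = 1 then xs else lmul t j 1 xs), \<not> e))"

text \<open>Left multiplication on normal forms gives an action of the presented group; evaluating it at the
  empty normal form shows that distinct normal forms are distinct group elements.\<close>

lemma star_group_normal_form_hom:
  assumes n: "1 \<le> n" and t: "\<And>i. i \<in> {2..n} \<Longrightarrow> 3 \<le> t i"
  defines "S \<equiv> {xs. reduced {2..n} t xs} \<times> (UNIV :: bool set)"
  shows "\<exists>\<phi>\<in>hom (star_group n t) (BijGroup S). \<forall>j\<in>{1..n}. \<phi> (gen n t j) = state_act n t j"
proof -
  let ?B = "BijGroup S"
  interpret B: group ?B by (rule group_BijGroup)
  have lm: "reduced {2..n} t (lmul t j a xs)" if "j \<in> {2..n}" "reduced {2..n} t xs" for j a xs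
    using reduced_lmul[OF that(2,1)] t[OF that(1)] by simp
  have into: "state_act n t j \<in> S \<rightarrow> S" if "j \<in> {1..n}" for j
    using that by (auto simp: state_act_def S_def intro!: reduced_neg lm)
  \<comment> \<open>The relations making the generators involutions; for \<open>j\<close> other than
    1 they rest on \<open>neg_lmul\<close>.\<close>
  have invol: "state_act n t j (state_act n t j x) = x" if "j \<in> {1..n}" and xS: "x \<in> S" for j x
  proof -
    obtain xs e where x: "x = (xs, e)" "reduced {2..n} t xs" using xS by (auto simp: S_def)
    show ?thesis
    proof (cases "j = 1")
      case True
      then show ?thesis using x by (simp add: state_act_def reduced_neg neg_neg)
    next
      case False
      then have j: "j \<in> {2..n}" using that by auto
      then show ?thesis using x False t[OF j] lm[OF j x(2)] neg_lmul[OF x(2), of j 1]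
        by (simp add: state_act_def reduced_neg)
    qed
  qed
  have bij: "state_act n t j \<in> Bij S" if j: "j \<in> {1..n}" for j
  proof -
    have "bij_betw (state_act n t j) S S"
      by (rule bij_betw_byWitness[where f' = "state_act n t j"]) (use invol[OF j] into[OF j] in auto)
    then show ?thesis by (simp add: Bij_def state_act_def S_def)
  qed
  have mult: "f \<otimes>\<^bsub>?B\<^esub> g = compose S f g" if "f \<in> Bij S" "g \<in> Bij S" for f g
    using that by (simp add: BijGroup_def)
  have carr: "carrier ?B = Bij S" and one: "\<one>\<^bsub>?B\<^esub> = (\<lambda>x\<in>S. x)" by (simp_all add: BijGroup_def)
  have memS: "(xs, e) \<in> S \<longleftrightarrow> reduced {2..n} t xs" for xs e by (simp add: S_def)
  have one_app: "\<one>\<^bsub>?B\<^esub> x = x" if "x \<in> S" for x using that by (simp add: one)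
  show ?thesis
  proof (rule B.star_group_hom)
    fix j assume j: "j \<in> {1..n}"
    show "state_act n t j \<in> carrier ?B" using bij[OF j] carr by simp
    show "state_act n t j \<otimes>\<^bsub>?B\<^esub> state_act n t j = \<one>\<^bsub>?B\<^esub>"
      using bij[OF j] invol[OF j] by (auto simp: mult one compose_def)
  next
    fix i assume i: "i \<in> {2..n}"
    let ?r = "state_act n t 1 \<otimes>\<^bsub>?B\<^esub> state_act n t i"
    have b: "state_act n t 1 \<in> Bij S" "state_act n t i \<in> Bij S" using bij i n by auto
    have rB: "?r \<in> Bij S" using B.m_closed b unfolding carr by blast
    \<comment> \<open>The two negations and the two sign changes cancel, so
      \<open>w\<^sub>1 w\<^sub>i\<close> acts as a single \<open>lmul\<close>.\<close>
    have r: "?r (xs, e) = (lmul t i 1 xs, e)" if "reduced {2..n} t xs" for xs e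
    proof -
      have "(xs, e) \<in> S" using that by (simp add: S_def)
      then have "?r (xs, e) = state_act n t 1 (state_act n t i (xs, e))"
        by (simp only: mult[OF b] compose_eq)
      then show ?thesis
        using that i lm[OF i that, of 1] neg_neg[OF lm[OF i that, of 1]]
        by (simp add: state_act_def reduced_neg)
    qed
    have pow: "(?r [^]\<^bsub>?B\<^esub> k) (xs, e) = (lmul t i k xs, e)" if "reduced {2..n} t xs" for k xs e
      using that
    proof (induction k arbitrary: xs)
      case 0
      then show ?case using t[OF i] by (simp add: one_app memS lmul_multiple)
    next
      case (Suc k)
      have "?r [^]\<^bsub>?B\<^esub> k \<in> Bij S" using B.nat_pow_closed rB unfolding carr by blast
      moreover have "(xs, e) \<in> S" using Suc.prems by (simp add: S_def)
      ultimately have "(?r [^]\<^bsub>?B\<^esub> Suc k) (xs, e) = (?r [^]\<^bsub>?B\<^esub> k) (?r (xs, e))"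
        by (simp only: nat_pow_Suc mult[OF _ rB] compose_eq)
      also have "\<dots> = (lmul t i k (lmul t i 1 xs), e)"
        unfolding r[OF Suc.prems] by (rule Suc.IH[OF lm[OF i Suc.prems]])
      finally show ?case
        using lmul_lmul[OF Suc.prems, of i k 1] t[OF i] by simp
    qed
    show "?r [^]\<^bsub>?B\<^esub> t i = \<one>\<^bsub>?B\<^esub>"
    proof (rule extensionalityI[of _ S])
      have "?r [^]\<^bsub>?B\<^esub> t i \<in> Bij S" using B.nat_pow_closed rB unfolding carr by blast
      then show "?r [^]\<^bsub>?B\<^esub> t i \<in> extensional S" by (rule Bij_imp_extensional)
      show "(?r [^]\<^bsub>?B\<^esub> t i) x = \<one>\<^bsub>?B\<^esub> x" if "x \<in> S" for x
        using that t[OF i] by (cases x) (auto simp: memS pow one_app lmul_multiple simp del: One_nat_def)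
    qed (simp add: one)
  qed
qed

text \<open>Normal forms exist because left multiplication by a generator preserves them. They are
  unique because \<open>nf xs e\<close>, acting on the empty state, yields \<open>(xs, e)\<close>.
  The assumption \<open>extend\<close> comes from the presentation.\<close>

lemma star_group_aut_star_group:
  assumes n: "2 \<le> n" and t: "\<And>i. i \<in> {2..n} \<Longrightarrow> 3 \<le> t i" and odd: "\<And>i. i \<in> {2..n} \<Longrightarrow> odd (t i)"
  shows "star_group_aut (star_group n t) {2..n} t (gen n t 1) (rho n t)"
proof -
  note One_nat_def [simp del] \<comment> \<open>keeps the locale parameter \<open>gen n t 1\<close> matchable by the simplifier\<close>
  have n1: "1 \<le> n" using n by simp
  let ?W = "star_group n t"
  interpret star_rel ?W "{2..n}" t "gen n t 1" "rho n t" by (rule star_rel_star_group[OF n1 t])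
  define S where "S = {xs. reduced {2..n} t xs} \<times> (UNIV :: bool set)"
  let ?B = "BijGroup S"
  interpret B: group ?B by (rule group_BijGroup)
  obtain \<phi> where \<phi>h: "\<phi> \<in> hom ?W ?B" and \<phi>: "\<And>j. j \<in> {1..n} \<Longrightarrow> \<phi> (gen n t j) = state_act n t j"
    using star_group_normal_form_hom[of n t, OF n1] t unfolding S_def by blast
  interpret \<phi>: group_hom ?W ?B \<phi> using \<phi>h by unfold_locales
  have carr: "carrier ?B = Bij S" and one: "\<one>\<^bsub>?B\<^esub> = (\<lambda>x\<in>S. x)" by (simp_all add: BijGroup_def)
  have memS: "(xs, e) \<in> S \<longleftrightarrow> reduced {2..n} t xs" for xs e by (simp add: S_def)
  have one_app: "\<one>\<^bsub>?B\<^esub> x = x" if "x \<in> S" for x using that by (simp add: one)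
  have app: "\<phi> (x \<otimes>\<^bsub>?W\<^esub> y) z = \<phi> x (\<phi> y z)" if "x \<in> carrier ?W" "y \<in> carrier ?W" "z \<in> S" for x y z
    using that \<phi>.hom_closed[OF that(1)] \<phi>.hom_closed[OF that(2)]
    by (simp add: BijGroup_def compose_eq)
  have gen_app: "\<phi> (gen n t 1) (xs, e) = (neg t xs, \<not> e)" if "reduced {2..n} t xs" for xs e
    using that n1 by (simp add: \<phi> state_act_def)
  have rho_app: "\<phi> (rho n t i) (xs, e) = (lmul t i 1 xs, e)" if "reduced {2..n} t xs" "i \<in> {2..n}" for xs e i
  proof -
    have red: "reduced {2..n} t (lmul t i 1 xs)" using that t[OF that(2)] by (intro reduced_lmul) auto
    have "\<phi> (rho n t i) (xs, e) = \<phi> (gen n t 1) (\<phi> (gen n t i) (xs, e))"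
      unfolding rho_def using that n1 by (intro app) (auto simp: gen_closed memS)
    also have "\<phi> (gen n t i) (xs, e) = (neg t (lmul t i 1 xs), \<not> e)"
      using that by (simp add: \<phi> state_act_def)
    finally show ?thesis using gen_app[OF reduced_neg[OF red]] red by (simp add: neg_neg)
  qed
  have pow_app: "\<phi> (rho n t i [^]\<^bsub>?W\<^esub> k) (xs, e) = (lmul t i k xs, e)"
    if "reduced {2..n} t xs" "i \<in> {2..n}" for xs e i k
    using that
  proof (induction k arbitrary: xs)
    case 0
    then show ?case using t[OF 0(2)] by (simp add: one_app memS lmul_multiple)
  next
    case (Suc k)
    have red: "reduced {2..n} t (lmul t i 1 xs)" using Suc.prems t[OF Suc.prems(2)] by (intro reduced_lmul) auto
    have "\<phi> (rho n t i [^]\<^bsub>?W\<^esub> Suc k) (xs, e) = \<phi> (rho n t i [^]\<^bsub>?W\<^esub> k) (\<phi> (rho n t i) (xs, e))"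
      unfolding nat_pow_Suc using Suc.prems by (intro app) (auto simp: memS)
    also have "\<dots> = (lmul t i k (lmul t i 1 xs), e)"
      using Suc.IH[OF red Suc.prems(2)] Suc.prems by (simp add: rho_app)
    finally show ?case using lmul_lmul[OF Suc.prems(1), of i k 1] t[OF Suc.prems(2)] by (simp add: One_nat_def)
  qed
  have rots_app: "\<phi> (rots xs) ([], e) = (xs, e)" if "reduced {2..n} t xs" for xs e
    using that
  proof (induction xs)
    case Nil
    then show ?case by (simp add: one_app memS)
  next
    case (Cons x xs)
    obtain i a where x: "x = (i, a)" by fastforce
    with Cons.prems have i: "i \<in> {2..n}" and xs: "reduced {2..n} t xs"
      and lm: "lmul t i a xs = (i, a) # xs"
      using lmul_reduced_Cons[of "{2..n}" t i a xs] by (auto simp: reduced_Cons)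
    have "\<phi> (rots (x # xs)) ([], e) = \<phi> (rho n t i [^]\<^bsub>?W\<^esub> a) (\<phi> (rots xs) ([], e))"
      unfolding x rots_Cons using i reduced_letters[OF xs] by (intro app) (auto simp: memS)
    then show ?case using Cons.IH[OF xs] pow_app[OF xs i] lm x by simp
  qed
  have nf_app: "\<phi> (nf xs e) ([], False) = (xs, e)" if xs: "reduced {2..n} t xs" for xs e
  proof -
    have "\<phi> (nf xs e) ([], False) = \<phi> (rots xs) (\<phi> (sgn e) ([], False))"
      unfolding nf_def using reduced_letters[OF xs] by (intro app) (auto simp: memS)
    also have "\<phi> (sgn e) ([], False) = ([], e)"
      using gen_app[of "[]"] by (simp add: sgn_def one_app memS)
    finally show ?thesis using rots_app[OF xs] by simp
  qed
  show ?thesis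
  proof unfold_locales
    show "finite {2..n}" "{2..n} \<noteq> {}" using n by auto
    show "odd (t i)" if "i \<in> {2..n}" for i by (rule odd[OF that])
  next
    fix g assume "g \<in> carrier ?W"
    then show "\<exists>xs e. reduced {2..n} t xs \<and> g = nf xs e"
    proof (induction rule: star_group_induct)
      case one
      show ?case by (intro exI[of _ "[]"] exI[of _ False]) (simp add: nf_def sgn_def)
    next
      case (mult j g)
      then obtain xs e where xs: "reduced {2..n} t xs" and g: "g = nf xs e" by blast
      have s: "\<exists>ys f. reduced {2..n} t ys \<and> gen n t 1 \<otimes>\<^bsub>?W\<^esub> nf xs e = nf ys f"
        if "reduced {2..n} t xs" for xs e
        using s_nf[OF that] reduced_neg[OF that] by blast
      show ?case
      proof (cases "j = 1")
        case True
        then show ?thesis using s[OF xs] g by simp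
      next
        case False
        then have j: "j \<in> {2..n}" using mult by auto
        have red: "reduced {2..n} t (lmul t j 1 xs)" using xs j t[OF j] by (intro reduced_lmul) auto
        have "gen n t j \<otimes>\<^bsub>?W\<^esub> g = gen n t 1 \<otimes>\<^bsub>?W\<^esub> (rho n t j \<otimes>\<^bsub>?W\<^esub> g)"
          using gen_eq_s_rho[OF n1 j] mult j by (simp add: m_assoc)
        also have "rho n t j \<otimes>\<^bsub>?W\<^esub> g = nf (lmul t j 1 xs) e"
          using r_nf[OF xs j, of 1] j by (simp add: g)
        finally show ?thesis using s[OF red] by simp
      qed
    qed
  next
    fix xs ys e f assume *: "reduced {2..n} t xs" "reduced {2..n} t ys" "nf xs e = nf ys f"
    show "xs = ys \<and> e = f"
      using nf_app[OF *(1), of e] nf_app[OF *(2), of f] unfolding *(3) by simp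
  next
    fix \<alpha> c assume \<alpha>: "\<And>i. i \<in> {2..n} \<Longrightarrow> \<alpha> i \<in> {2..n} \<and> t (\<alpha> i) = t i"
    let ?s = "gen n t 1"
    define x where "x i = rho n t (\<alpha> i) [^]\<^bsub>?W\<^esub> (c i :: nat)" for i
    \<comment> \<open>The generator \<open>j\<close> equals \<open>?s\<close> times the rotation
      \<open>j\<close>, so its image has to be \<open>?s\<close> times the prescribed power.\<close>
    define f where "f j = (if j = 1 then ?s else ?s \<otimes>\<^bsub>?W\<^esub> x j)" for j
    have x: "x i \<in> carrier ?W" "?s \<otimes>\<^bsub>?W\<^esub> x i \<otimes>\<^bsub>?W\<^esub> ?s = inv\<^bsub>?W\<^esub> x i"
      "x i [^]\<^bsub>?W\<^esub> t i = \<one>\<^bsub>?W\<^esub>" if "i \<in> {2..n}" for i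
    proof -
      have \<alpha>i: "\<alpha> i \<in> {2..n}" "t (\<alpha> i) = t i" using \<alpha>[OF that] by auto
      show "x i \<in> carrier ?W" "?s \<otimes>\<^bsub>?W\<^esub> x i \<otimes>\<^bsub>?W\<^esub> ?s = inv\<^bsub>?W\<^esub> x i"
        using \<alpha>i(1) by (simp_all add: x_def s_r_pow)
      have "x i [^]\<^bsub>?W\<^esub> t i = (rho n t (\<alpha> i) [^]\<^bsub>?W\<^esub> t (\<alpha> i)) [^]\<^bsub>?W\<^esub> c i"
        using \<alpha>i by (simp add: x_def nat_pow_pow mult.commute del: r_order)
      then show "x i [^]\<^bsub>?W\<^esub> t i = \<one>\<^bsub>?W\<^esub>" using r_order[OF \<alpha>i(1)] by simp
    qed
    have "\<exists>\<psi>\<in>hom ?W ?W. \<forall>j\<in>{1..n}. \<psi> (gen n t j) = f j"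
    proof (rule star_group_hom)
      fix j assume j: "j \<in> {1..n}"
      show "f j \<in> carrier ?W" using x(1)[of j] j by (cases "j = 1") (auto simp: f_def)
      show "f j \<otimes>\<^bsub>?W\<^esub> f j = \<one>\<^bsub>?W\<^esub>"
      proof (cases "j = 1")
        case False
        then have j: "j \<in> {2..n}" using j by auto
        \<comment> \<open>The square is the conjugate of \<open>x j\<close> by \<open>?s\<close>,
          which is its inverse, times \<open>x j\<close>.\<close>
        have "f j \<otimes>\<^bsub>?W\<^esub> f j = (?s \<otimes>\<^bsub>?W\<^esub> x j \<otimes>\<^bsub>?W\<^esub> ?s) \<otimes>\<^bsub>?W\<^esub> x j"
          using False x(1)[OF j] by (simp add: f_def m_assoc)
        then show ?thesis using x[OF j] by simp
      qed (simp add: f_def)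
    next
      fix i assume i: "i \<in> {2..n}"
      show "(f 1 \<otimes>\<^bsub>?W\<^esub> f i) [^]\<^bsub>?W\<^esub> t i = \<one>\<^bsub>?W\<^esub>"
        using i x[OF i] by (simp add: f_def)
    qed
    then obtain \<psi> where \<psi>h: "\<psi> \<in> hom ?W ?W" and \<psi>: "\<And>j. j \<in> {1..n} \<Longrightarrow> \<psi> (gen n t j) = f j" by blast
    interpret \<psi>: group_hom ?W ?W \<psi> using \<psi>h by unfold_locales
    have "\<psi> (rho n t i) = x i" if i: "i \<in> {2..n}" for i
    proof -
      have "\<psi> (rho n t i) = f 1 \<otimes>\<^bsub>?W\<^esub> f i"
        unfolding rho_def using i n1 by (simp add: gen_closed \<psi>)
      then show ?thesis using i x(1)[OF i] by (simp add: f_def)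
    qed
    moreover have "\<psi> ?s = ?s" using \<psi>[of 1] n1 by (simp add: f_def)
    ultimately show "\<exists>\<phi>\<in>hom ?W ?W. \<phi> ?s = ?s \<and> (\<forall>i\<in>{2..n}. \<phi> (rho n t i) = rho n t (\<alpha> i) [^]\<^bsub>?W\<^esub> c i)"
      using \<psi>h by (intro bexI[of _ \<psi>]) (auto simp: x_def)
  qed
qed

section \<open>Blocks and generators\<close>

lemma block_unique:
  assumes "i \<in> block k j" "i \<in> block k j'"
  shows "j = j'"
proof -
  have False if "i \<in> block k a" "i \<in> block k b" "a < b" for a b
  proof -
    have "(\<Sum>s\<in>{1..a}. k s) \<le> (\<Sum>s\<in>{1..<b}. k s)"
      using that(3) by (intro sum_mono2) auto
    then show False using that(1,2) by (simp add: block_def)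
  qed
  then show ?thesis using assms by (meson linorder_neqE_nat)
qed

lemma block_exists:
  assumes "i \<in> {2..1 + (\<Sum>s\<in>{1..l}. k s)}"
  shows "\<exists>j\<in>{1..l}. i \<in> block k j"
  using assms
proof (induction l)
  case (Suc l)
  show ?case
  proof (cases "i \<in> {2..1 + (\<Sum>s\<in>{1..l}. k s)}")
    case True
    then show ?thesis using Suc.IH by fastforce
  next
    case False
    then have "i \<in> block k (Suc l)" using Suc.prems by (auto simp: block_def atLeastLessThanSuc_atLeastAtMost)
    then show ?thesis by (intro bexI[of _ "Suc l"]) auto
  qed
qed simp

lemma block_subset:
  assumes "j \<in> {1..l}"
  shows "block k j \<subseteq> {2..1 + (\<Sum>s\<in>{1..l}. k s)}"
proof -
  have "(\<Sum>s\<in>{1..j}. k s) \<le> (\<Sum>s\<in>{1..l}. k s)" using assms by (intro sum_mono2) auto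
  then show ?thesis by (auto simp: block_def)
qed

lemma block_singleton:
  assumes "1 \<le> j" "k j = 1"
  obtains a where "block k j = {a}"
proof -
  have "{1..j} = insert j {1..<j}" using assms(1) by auto
  then have "(\<Sum>s\<in>{1..j}. k s) = 1 + (\<Sum>s\<in>{1..<j}. k s)" using assms(2) by simp
  then show ?thesis using that[of "2 + (\<Sum>s\<in>{1..<j}. k s)"] by (auto simp: block_def)
qed

lemma expo_block: "j \<in> {1..l} \<Longrightarrow> i \<in> block k j \<Longrightarrow> expo l m k i = m j"
  unfolding expo_def by (rule arg_cong[of _ _ m], rule the_equality) (auto intro: block_unique)

text \<open>As the \<open>m j\<close> are distinct, the blocks are the level sets of
  \<open>expo\<close> on \<open>{2..n}\<close>; an injection of a finite block into itself is
  onto.\<close>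

lemma block_invariant_iff_expo_invariant:
  assumes \<alpha>: "\<alpha> permutes {2..n}" and n: "(\<Sum>j\<in>{1..l}. k j) = n - 1" "1 \<le> n"
    and m: "inj_on m {1..l}"
  shows "(\<forall>j\<in>{1..l}. \<alpha> ` block k j = block k j) \<longleftrightarrow>
    (\<forall>i\<in>{2..n}. expo l m k (\<alpha> i) = expo l m k i)"
proof
  have range: "{2..1 + (\<Sum>s\<in>{1..l}. k s)} = {2..n}" using n by simp
  {
    assume inv: "\<forall>j\<in>{1..l}. \<alpha> ` block k j = block k j"
    show "\<forall>i\<in>{2..n}. expo l m k (\<alpha> i) = expo l m k i"
    proof
      fix i assume "i \<in> {2..n}"
      then obtain j where j: "j \<in> {1..l}" "i \<in> block k j" using block_exists[of i k l] range by blast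
      then have "\<alpha> i \<in> block k j" using inv by blast
      then show "expo l m k (\<alpha> i) = expo l m k i" using j by (simp add: expo_block)
    qed
  next
    assume inv: "\<forall>i\<in>{2..n}. expo l m k (\<alpha> i) = expo l m k i"
    show "\<forall>j\<in>{1..l}. \<alpha> ` block k j = block k j"
    proof
      fix j assume j: "j \<in> {1..l}"
      have sub: "\<alpha> ` block k j \<subseteq> block k j"
      proof (rule image_subsetI)
        fix i assume i: "i \<in> block k j"
        then have "i \<in> {2..n}" using block_subset[OF j, of k] range by blast
        then have "\<alpha> i \<in> {2..n}" "expo l m k (\<alpha> i) = m j"
          using permutes_in_image[OF \<alpha>] inv expo_block[OF j i, of m] by auto
        moreover from this obtain j' where j': "j' \<in> {1..l}" "\<alpha> i \<in> block k j'"
          using block_exists[of "\<alpha> i" k l] range by blast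
        ultimately have "m j' = m j" using expo_block[OF j', of m] by simp
        then show "\<alpha> i \<in> block k j" using m j j' by (metis inj_onD)
      qed
      show "\<alpha> ` block k j = block k j"
        using sub by (rule endo_inj_surj[rotated]) (auto simp: block_def intro: inj_on_subset[OF permutes_inj[OF \<alpha>]])
    qed
  }
qed

section \<open>The concrete groups \<open>C\<close> and \<open>G\<close> as \<open>diag\<close> and
  \<open>graphs\<close>\<close>

context
  fixes n :: nat and t :: "nat \<Rightarrow> nat"
  assumes n: "2 \<le> n" and t: "\<And>i. i \<in> {2..n} \<Longrightarrow> 3 \<le> t i" and odd: "\<And>i. i \<in> {2..n} \<Longrightarrow> odd (t i)"
begin

interpretation star_group_aut "star_group n t" "{2..n}" t "gen n t 1" "rho n t"
  by (rule star_group_aut_star_group[OF n t odd])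

text \<open>Translates between the generators, in which \<open>theta\<close> and
  \<open>graph_aut\<close> are specified, and the rotations, by cancelling the involution on the
  left.\<close>

lemma aut_gen_iff:
  assumes \<phi>: "\<phi> \<in> auto (star_group n t)" "\<phi> (gen n t 1) = gen n t 1"
    and i: "i \<in> {2..n}" and x: "x \<in> carrier (star_group n t)"
  shows "\<phi> (gen n t i) = gen n t 1 \<otimes>\<^bsub>star_group n t\<^esub> x \<longleftrightarrow> \<phi> (rho n t i) = x"
proof -
  have "gen n t i = gen n t 1 \<otimes>\<^bsub>star_group n t\<^esub> rho n t i" using n i by (intro gen_eq_s_rho) auto
  then have "\<phi> (gen n t i) = gen n t 1 \<otimes>\<^bsub>star_group n t\<^esub> \<phi> (rho n t i)"
    using auto_mult[OF \<phi>(1) s_closed r_closed[OF i]] \<phi>(2) by simp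
  then show ?thesis
    using l_cancel[OF _ _ _ s_closed] auto_closed[OF \<phi>(1) r_closed[OF i]] x by metis
qed

text \<open>Evaluates the definite description in \<open>theta\<close>: uniqueness holds because the
  values on the involution and the rotations determine an automorphism.\<close>

lemma theta_eqI:
  assumes i: "i \<in> {2..n}" and \<phi>: "\<phi> \<in> auto (star_group n t)" "\<phi> (gen n t 1) = gen n t 1"
    and \<phi>i: "\<phi> (rho n t i) = rho n t i [^]\<^bsub>star_group n t\<^esub> k"
    and \<phi>j: "\<And>j. j \<in> {2..n} \<Longrightarrow> j \<noteq> i \<Longrightarrow> \<phi> (rho n t j) = rho n t j"
  shows "theta n t i k = \<phi>"
  unfolding theta_def rho_def[symmetric]
proof (rule the_equality)
  have g: "gen n t j = gen n t 1 \<otimes>\<^bsub>star_group n t\<^esub> rho n t j" if "j \<in> {2..n}" for j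
    using n that by (intro gen_eq_s_rho) auto
  have "\<phi> (gen n t j) = gen n t j" if "j \<in> {1..n}" "j \<noteq> i" for j
  proof (cases "j = 1")
    case False
    then have j: "j \<in> {2..n}" using that by auto
    then show ?thesis using aut_gen_iff[OF \<phi> j r_closed[OF j]] \<phi>j[OF j that(2)] g[OF j] by simp
  qed (use \<phi>(2) in simp)
  moreover have "\<phi> (gen n t i) = gen n t 1 \<otimes>\<^bsub>star_group n t\<^esub> rho n t i [^]\<^bsub>star_group n t\<^esub> k"
    using aut_gen_iff[OF \<phi> i nat_pow_closed[OF r_closed[OF i]]] \<phi>i by blast
  ultimately show "\<phi> \<in> auto (star_group n t) \<and> (\<forall>j\<in>{1..n}. j \<noteq> i \<longrightarrow> \<phi> (gen n t j) = gen n t j) \<and>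
      \<phi> (gen n t i) = gen n t 1 \<otimes>\<^bsub>star_group n t\<^esub> rho n t i [^]\<^bsub>star_group n t\<^esub> k"
    using \<phi>(1) by blast
  fix \<psi> assume \<psi>: "\<psi> \<in> auto (star_group n t) \<and> (\<forall>j\<in>{1..n}. j \<noteq> i \<longrightarrow> \<psi> (gen n t j) = gen n t j) \<and>
      \<psi> (gen n t i) = gen n t 1 \<otimes>\<^bsub>star_group n t\<^esub> rho n t i [^]\<^bsub>star_group n t\<^esub> k"
  then have \<psi>a: "\<psi> \<in> auto (star_group n t)" and \<psi>s: "\<psi> (gen n t 1) = gen n t 1"
    using i n by auto
  show "\<psi> = \<phi>"
  proof (rule aut_eq[OF \<psi>a \<phi>(1)])
    show "\<psi> (gen n t 1) = \<phi> (gen n t 1)" using \<psi>s \<phi>(2) by simp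
    fix j assume j: "j \<in> {2..n}"
    show "\<psi> (rho n t j) = \<phi> (rho n t j)"
    proof (cases "j = i")
      case True
      then show ?thesis
        using aut_gen_iff[OF \<psi>a \<psi>s i nat_pow_closed[OF r_closed[OF i]]] \<psi> \<phi>i by blast
    next
      case False
      then have "\<psi> (gen n t j) = gen n t 1 \<otimes>\<^bsub>star_group n t\<^esub> rho n t j" using \<psi> j g[OF j] by auto
      then show ?thesis using aut_gen_iff[OF \<psi>a \<psi>s j r_closed[OF j]] \<phi>j[OF j False] by blast
    qed
  qed
qed

lemma Cgrp_eq_diag: "Cgrp n t = diag"
proof -
  have "{theta n t i k | i k. i \<in> {2..n} \<and> 1 \<le> k \<and> k < t i \<and> coprime k (t i)} = dilations"
  proof (intro equalityI subsetI)
    fix \<phi> assume "\<phi> \<in> {theta n t i k | i k. i \<in> {2..n} \<and> 1 \<le> k \<and> k < t i \<and> coprime k (t i)}"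
    then obtain i k where i: "i \<in> {2..n}" and k: "coprime k (t i)" and \<phi>: "\<phi> = theta n t i k" by blast
    obtain \<psi> where \<psi>: "\<psi> \<in> dilations" "\<psi> (rho n t i) = rho n t i [^]\<^bsub>star_group n t\<^esub> k"
      "\<And>j. j \<in> {2..n} \<Longrightarrow> j \<noteq> i \<Longrightarrow> \<psi> (rho n t j) = rho n t j"
      using dilation_exists[OF i k] by blast
    then have "\<psi> \<in> auto (star_group n t)" "\<psi> (gen n t 1) = gen n t 1"
      unfolding dilations_def diag_def stab_def by blast+
    then show "\<phi> \<in> dilations" using theta_eqI[OF i _ _ \<psi>(2,3)] \<psi>(1) \<phi> by blast
  next
    fix \<phi> assume \<phi>: "\<phi> \<in> dilations"
    then obtain i where i: "i \<in> {2..n}" and \<phi>j: "\<And>j. j \<in> {2..n} \<Longrightarrow> j \<noteq> i \<Longrightarrow> \<phi> (rho n t j) = rho n t j"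
      and a: "\<exists>a::nat. \<phi> (rho n t i) = rho n t i [^]\<^bsub>star_group n t\<^esub> a"
      and \<phi>a: "\<phi> \<in> auto (star_group n t)" "\<phi> (gen n t 1) = gen n t 1"
      unfolding dilations_def diag_def stab_def by blast
    obtain a :: nat where a: "\<phi> (rho n t i) = rho n t i [^]\<^bsub>star_group n t\<^esub> a" using a by blast
    have cop: "coprime (a mod t i) (t i)" using diag_coprime[OF \<phi>a(1) i a] t[OF i] by simp
    then have "1 \<le> a mod t i" using t[OF i] by (cases "a mod t i = 0") auto
    moreover have "a mod t i < t i" using t[OF i] by simp
    moreover have "theta n t i (a mod t i) = \<phi>"
      by (rule theta_eqI[OF i \<phi>a]) (use a \<phi>j r_pow_mod[OF i] in auto)
    ultimately show "\<phi> \<in> {theta n t i k | i k. i \<in> {2..n} \<and> 1 \<le> k \<and> k < t i \<and> coprime k (t i)}"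
      using cop i by blast
  qed
  then show ?thesis unfolding Cgrp_def using generate_dilations by simp
qed

text \<open>Uniqueness on generators again evaluates the definite description; existence comes from
  \<open>extend_auto\<close> with all exponents 1.\<close>

lemma graphs_eq: "graphs = {graph_aut n t \<alpha> | \<alpha>. \<alpha> permutes {2..n} \<and> (\<forall>i\<in>{2..n}. t (\<alpha> i) = t i)}"
proof -
  have g: "gen n t j = gen n t 1 \<otimes>\<^bsub>star_group n t\<^esub> rho n t j" if "j \<in> {2..n}" for j
    using n that by (intro gen_eq_s_rho) auto
  have eq: "graph_aut n t \<alpha> = \<phi>"
    if \<alpha>: "\<alpha> permutes {2..n}" and \<phi>: "\<phi> \<in> auto (star_group n t)" "\<phi> (gen n t 1) = gen n t 1"
      and r: "\<And>i. i \<in> {2..n} \<Longrightarrow> \<phi> (rho n t i) = rho n t (\<alpha> i)" for \<alpha> \<phi>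
  proof -
    have iff: "\<psi> (gen n t i) = gen n t (\<alpha> i) \<longleftrightarrow> \<psi> (rho n t i) = rho n t (\<alpha> i)"
      if "\<psi> \<in> auto (star_group n t)" "\<psi> (gen n t 1) = gen n t 1" "i \<in> {2..n}" for \<psi> i
    proof -
      have "\<alpha> i \<in> {2..n}" using permutes_in_image[OF \<alpha>] that(3) by simp
      then show ?thesis using aut_gen_iff[OF that r_closed] g by simp
    qed
    show ?thesis
      unfolding graph_aut_def
    proof (rule the_equality)
      show "\<phi> \<in> auto (star_group n t) \<and> \<phi> (gen n t 1) = gen n t 1 \<and>
        (\<forall>i\<in>{2..n}. \<phi> (gen n t i) = gen n t (\<alpha> i))"
        using \<phi> iff[OF \<phi>] r by blast
      fix \<psi> assume \<psi>: "\<psi> \<in> auto (star_group n t) \<and> \<psi> (gen n t 1) = gen n t 1 \<and>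
        (\<forall>i\<in>{2..n}. \<psi> (gen n t i) = gen n t (\<alpha> i))"
      show "\<psi> = \<phi>"
        by (rule aut_eq) (use \<psi> \<phi> iff[of \<psi>] r in \<open>auto simp del: One_nat_def\<close>)
    qed
  qed
  show ?thesis
  proof (intro equalityI subsetI)
    fix \<phi> assume "\<phi> \<in> graphs"
    then obtain \<alpha> where "\<phi> \<in> stab" "\<alpha> permutes {2..n}"
      "\<And>i. i \<in> {2..n} \<Longrightarrow> t (\<alpha> i) = t i" "\<And>i. i \<in> {2..n} \<Longrightarrow> \<phi> (rho n t i) = rho n t (\<alpha> i)"
      unfolding graphs_def by blast
    then show "\<phi> \<in> {graph_aut n t \<alpha> | \<alpha>. \<alpha> permutes {2..n} \<and> (\<forall>i\<in>{2..n}. t (\<alpha> i) = t i)}"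
      using eq[of \<alpha> \<phi>] unfolding stab_def by blast
  next
    fix \<phi> assume "\<phi> \<in> {graph_aut n t \<alpha> | \<alpha>. \<alpha> permutes {2..n} \<and> (\<forall>i\<in>{2..n}. t (\<alpha> i) = t i)}"
    then obtain \<alpha> where \<phi>: "\<phi> = graph_aut n t \<alpha>" and \<alpha>: "\<alpha> permutes {2..n}" "\<And>i. i \<in> {2..n} \<Longrightarrow> t (\<alpha> i) = t i"
      by blast
    obtain \<psi> where \<psi>: "\<psi> \<in> auto (star_group n t)" "\<psi> (gen n t 1) = gen n t 1"
      and "\<forall>i\<in>{2..n}. \<psi> (rho n t i) = rho n t (\<alpha> i) [^]\<^bsub>star_group n t\<^esub> (1::nat)"
      using extend_auto[OF \<alpha>, of "\<lambda>_. 1"] by (metis coprime_1_left)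
    then have r: "\<psi> (rho n t i) = rho n t (\<alpha> i)" if "i \<in> {2..n}" for i
      using that r_closed[of "\<alpha> i"] permutes_in_image[OF \<alpha>(1)] nat_pow_eone by metis
    then have "\<psi> \<in> graphs" using \<psi> \<alpha> unfolding graphs_def stab_def by blast
    then show "\<phi> \<in> graphs" using eq[OF \<alpha>(1) \<psi> r] \<phi> by simp
  qed
qed

end

section \<open>The splitting for the given blocks and exponents\<close>

theorem theorem4p5:
  fixes n l :: nat and m k :: "nat \<Rightarrow> nat"
  assumes n3: "n \<ge> 3"
    and m_odd: "\<forall>j\<in>{1..l}. odd (m j) \<and> m j \<ge> 3"
    and m_inj: "inj_on m {1..l}"
    and k_pos: "\<forall>j\<in>{1..l}. k j \<ge> 1"
    and k_sum: "(\<Sum>j\<in>{1..l}. k j) = n - 1"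
    and hyp: "\<exists>i\<in>{1..l}. k i = 1 \<and> (\<exists>p::nat. Factorial_Ring.prime p \<and> p mod 4 = 3 \<and> p dvd m i)"
  shows "\<exists>D. subgroup D (Aut (star_group n (expo l m k)))
           \<and> D \<subseteq> Cgrp n (expo l m k)
           \<and> D \<inter> generate (Aut (star_group n (expo l m k)))
                   {inner (star_group n (expo l m k)) (gen n (expo l m k) 1)}
               = {\<one>\<^bsub>Aut (star_group n (expo l m k))\<^esub>}
           \<and> Cgrp n (expo l m k)
               = D <#>\<^bsub>Aut (star_group n (expo l m k))\<^esub>
                 generate (Aut (star_group n (expo l m k)))
                   {inner (star_group n (expo l m k)) (gen n (expo l m k) 1)}
           \<and> (\<forall>g\<in>Ggrp n l k (expo l m k).
                (\<lambda>d. g \<otimes>\<^bsub>Aut (star_group n (expo l m k))\<^esub> d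
                      \<otimes>\<^bsub>Aut (star_group n (expo l m k))\<^esub>
                      inv\<^bsub>Aut (star_group n (expo l m k))\<^esub> g) ` D = D)
           \<and> subgroup (D <#>\<^bsub>Aut (star_group n (expo l m k))\<^esub> Ggrp n l k (expo l m k))
                (Aut (star_group n (expo l m k)))
           \<and> (D <#>\<^bsub>Aut (star_group n (expo l m k))\<^esub> Ggrp n l k (expo l m k))
               \<inter> Inn (star_group n (expo l m k)) = {\<one>\<^bsub>Aut (star_group n (expo l m k))\<^esub>}
           \<and> (D <#>\<^bsub>Aut (star_group n (expo l m k))\<^esub> Ggrp n l k (expo l m k))
               <#>\<^bsub>Aut (star_group n (expo l m k))\<^esub> Inn (star_group n (expo l m k))
               = carrier (Aut (star_group n (expo l m k)))
           \<and> Out (star_group n (expo l m k))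
               \<cong> conj_semidirect (Aut (star_group n (expo l m k))) D (Ggrp n l k (expo l m k))"
proof -
  let ?t = "expo l m k"
  have n: "2 \<le> n" and n1: "1 \<le> n" using n3 by simp_all
  have range: "{2..1 + (\<Sum>s\<in>{1..l}. k s)} = {2..n}" using k_sum n1 by simp
  have ex: "\<exists>j\<in>{1..l}. i \<in> block k j \<and> ?t i = m j" if "i \<in> {2..n}" for i
    using block_exists[of i k l] that range expo_block[of _ l i k m] by blast
  have t: "3 \<le> ?t i" and odd: "odd (?t i)" if "i \<in> {2..n}" for i
    using ex[OF that] m_odd by auto
  interpret S: star_group_aut "star_group n ?t" "{2..n}" ?t "gen n ?t 1" "rho n ?t"
    by (rule star_group_aut_star_group[OF n t odd])
  obtain j p where j: "j \<in> {1..l}" "k j = 1" and p: "Factorial_Ring.prime p" "p mod 4 = 3" "p dvd m j"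
    using hyp by blast
  \<comment> \<open>The block of an exponent occurring once is a singleton; its element is the index
    on which \<open>D\<close> imposes its condition.\<close>
  obtain i where i: "block k j = {i}" using block_singleton[of j k] j by auto
  have iI: "i \<in> {2..n}" using block_subset[OF j(1), of k] i range by blast
  have ti: "?t i = m j" using expo_block[OF j(1), of i k m] i by simp
  \<comment> \<open>Distinct blocks carry distinct exponents, so an equal exponent means the same
    block.\<close>
  have unique: "i' = i" if "i' \<in> {2..n}" "?t i' = ?t i" for i'
  proof -
    obtain j' where "j' \<in> {1..l}" "i' \<in> block k j'" "?t i' = m j'" using ex[OF \<open>i' \<in> {2..n}\<close>] by blast
    then have "j' = j" using that(2) ti m_inj j(1) by (metis inj_onD)
    then show ?thesis using \<open>i' \<in> block k j'\<close> i by simp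
  qed
  have C: "Cgrp n ?t = S.diag" by (rule Cgrp_eq_diag[OF n t odd])
  have G: "Ggrp n l k ?t = S.graphs"
  proof -
    have "S.graphs = {graph_aut n ?t \<alpha> | \<alpha>. \<alpha> permutes {2..n} \<and> (\<forall>i\<in>{2..n}. ?t (\<alpha> i) = ?t i)}"
      by (rule graphs_eq[OF n t odd])
    also have "\<dots> = Ggrp n l k ?t"
      unfolding Ggrp_def using block_invariant_iff_expo_invariant[OF _ k_sum n1 m_inj] by blast
    finally show ?thesis by simp
  qed
  have "p dvd ?t i" using p(3) ti by simp
  note split = S.Out_split[OF iI unique p(1,2) this]
  show ?thesis
    unfolding C G using split by (intro exI[of _ "S.half_diag i p"] conjI)
qed

end
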